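(* Let $G=(V,E)$ be a 2T-graph whose generic components are circuits (that is, every generic component of $G$ is a single generic circuit of $G$). If the external edges of $G$ form a matching, then $G$ has a good ordering.
   Context: Graphs and digraphs may contain parallel edges and arcs, respectively, but no loops. $G[X]$ is the subgraph of $G$ induced by $X$. A 2T-graph is a graph whose edge set is the union of two edge-disjoint spanning trees. A graph $G=(V,E)$ is a generic circuit if $|E|=2|V|-2>0$ and $|E(G[X])|\le 2|X|-3$ for every $X\subset V$ with $2\le |X|\le |V|-1$. A generic circuit of a graph $G$ (also called a circuit of $G$) is an induced subgraph of $G$ which is a generic circuit. For a 2T-graph $G=(V,E)$ with generic circuits $G_i=(V_i,E_i)$, $1\le i\le r$, let $\mathcal{G}$ be the hypergraph on $V$ with hyperedges $V_1,\dots,V_r$. Two generic circuits of $G$ are connected if their vertex sets lie in the same connected component of $\mathcal{G}$. A generic component of $G$ is either a single vertex that lies in no generic circuit of $G$ (trivial) or the union of a maximal set of connected generic circuits (non-trivial). An edge of $G$ is external if it is not contained in any generic circuit of $G$. An out-branching (respectively in-branching) of a digraph $D$ with root $r$ is a spanning subdigraph whose arcs form a spanning tree of the underlying graph and in which every vertex $v\ne r$ has precisely one entering (respectively leaving) arc and $r$ has no entering (respectively leaving) arc. For a vertex ordering $\prec$ of $G$, $D_\prec$ is the acyclic orientation of $G$ in which each edge $uv$ is oriented from $u$ to $v$ if and only if $u\prec v$. The ordering $\prec$ is good if $D_\prec$ contains an out-branching and an in-branching that are arc-disjoint. *)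

theory Defs
  imports "Graph_Theory.Digraph_Component"
begin

section \<open>Finite loopless undirected multigraphs\<close>

text \<open>
  The undirected multigraphs below have abstract edges, so that parallel edges are distinct elements
  of \<open>'e\<close>. Digraphs are those of \<^theory>\<open>Graph_Theory.Digraph_Component\<close>; its \<^const>\<open>tree\<close> is not
  used because it only excludes directed cycles.
\<close>

record ('v, 'e) mgraph =
  mverts :: "'v set"
  medges :: "'e set"
  mends :: "'e \<Rightarrow> 'v set"

definition multigraph :: "('v, 'e) mgraph \<Rightarrow> bool" where
  "multigraph G \<longleftrightarrow> finite (mverts G) \<and> finite (medges G) \<and>
     (\<forall>e\<in>medges G. mends G e \<subseteq> mverts G \<and> card (mends G e) = 2)"

definition mg_subgraph :: "('v, 'e) mgraph \<Rightarrow> ('v, 'e) mgraph \<Rightarrow> bool" where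
  "mg_subgraph H G \<longleftrightarrow> multigraph H \<and> multigraph G \<and>
     mverts H \<subseteq> mverts G \<and> medges H \<subseteq> medges G \<and> mends H = mends G"

definition mg_induce :: "('v, 'e) mgraph \<Rightarrow> 'v set \<Rightarrow> ('v, 'e) mgraph" where
  "mg_induce G X = \<lparr>mverts = X, medges = {e \<in> medges G. mends G e \<subseteq> X}, mends = mends G\<rparr>"

definition mg_connected :: "('v, 'e) mgraph \<Rightarrow> bool" where
  "mg_connected G \<longleftrightarrow> mverts G \<noteq> {} \<and>
     (\<forall>u\<in>mverts G. \<forall>v\<in>mverts G. (u, v) \<in> {(x, y). \<exists>e\<in>medges G. mends G e = {x, y}}\<^sup>*)"

text \<open>Two parallel edges form a cycle of length 2.\<close>

definition mg_cycle :: "('v, 'e) mgraph \<Rightarrow> 'v list \<Rightarrow> 'e list \<Rightarrow> bool" where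
  "mg_cycle G vs es \<longleftrightarrow> length vs = length es \<and> 2 \<le> length es \<and>
     distinct vs \<and> distinct es \<and> set vs \<subseteq> mverts G \<and> set es \<subseteq> medges G \<and>
     (\<forall>i < length es. mends G (es ! i) = {vs ! i, vs ! (Suc i mod length vs)})"

definition mg_tree :: "('v, 'e) mgraph \<Rightarrow> bool" where
  "mg_tree T \<longleftrightarrow> multigraph T \<and> mg_connected T \<and> (\<nexists>vs es. mg_cycle T vs es)"

definition mg_spanning_tree :: "('v, 'e) mgraph \<Rightarrow> ('v, 'e) mgraph \<Rightarrow> bool" where
  "mg_spanning_tree T G \<longleftrightarrow> mg_subgraph T G \<and> mverts T = mverts G \<and> mg_tree T"

definition mg_matching :: "('v, 'e) mgraph \<Rightarrow> 'e set \<Rightarrow> bool" where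
  "mg_matching G M \<longleftrightarrow> M \<subseteq> medges G \<and>
     (\<forall>e\<in>M. \<forall>f\<in>M. e \<noteq> f \<longrightarrow> mends G e \<inter> mends G f = {})"

section \<open>2T-graphs, generic circuits and generic components\<close>

definition two_T_graph :: "('v, 'e) mgraph \<Rightarrow> bool" where
  "two_T_graph G \<longleftrightarrow> multigraph G \<and>
     (\<exists>T\<^sub>1 T\<^sub>2. mg_spanning_tree T\<^sub>1 G \<and> mg_spanning_tree T\<^sub>2 G \<and>
        medges T\<^sub>1 \<inter> medges T\<^sub>2 = {} \<and> medges G = medges T\<^sub>1 \<union> medges T\<^sub>2)"

definition generic_circuit :: "('v, 'e) mgraph \<Rightarrow> bool" where
  "generic_circuit G \<longleftrightarrow> multigraph G \<and>
     card (medges G) = 2 * card (mverts G) - 2 \<and> 2 * card (mverts G) - 2 > 0 \<and>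
     (\<forall>X. X \<subset> mverts G \<and> 2 \<le> card X \<and> card X \<le> card (mverts G) - 1 \<longrightarrow>
        card (medges (mg_induce G X)) \<le> 2 * card X - 3)"

definition circuit_of :: "('v, 'e) mgraph \<Rightarrow> ('v, 'e) mgraph \<Rightarrow> bool" where
  "circuit_of H G \<longleftrightarrow> (\<exists>X \<subseteq> mverts G. H = mg_induce G X) \<and> generic_circuit H"

text \<open>The vertex sets of the connected components of the hypergraph on \<open>V\<close> with hyperedges \<open>\<H>\<close>.\<close>

definition hypergraph_components :: "'v set \<Rightarrow> 'v set set \<Rightarrow> 'v set set" where
  "hypergraph_components V \<H> = V // (Restr ({(x, y). \<exists>X\<in>\<H>. x \<in> X \<and> y \<in> X}\<^sup>*) V)"

definition circuits_connected :: "('v, 'e) mgraph \<Rightarrow> ('v, 'e) mgraph \<Rightarrow> ('v, 'e) mgraph \<Rightarrow> bool" where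
  "circuits_connected G H K \<longleftrightarrow>
     (\<exists>C \<in> hypergraph_components (mverts G) (mverts ` {L. circuit_of L G}).
        mverts H \<subseteq> C \<and> mverts K \<subseteq> C)"

definition connected_circuit_set :: "('v, 'e) mgraph \<Rightarrow> ('v, 'e) mgraph set \<Rightarrow> bool" where
  "connected_circuit_set G \<C> \<longleftrightarrow> \<C> \<noteq> {} \<and> \<C> \<subseteq> {H. circuit_of H G} \<and>
     (\<forall>H\<in>\<C>. \<forall>K\<in>\<C>. circuits_connected G H K)"

definition trivial_generic_component :: "('v, 'e) mgraph \<Rightarrow> ('v, 'e) mgraph \<Rightarrow> bool" where
  "trivial_generic_component G H \<longleftrightarrow>
     (\<exists>v\<in>mverts G. (\<forall>K. circuit_of K G \<longrightarrow> v \<notin> mverts K) \<and>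
        H = \<lparr>mverts = {v}, medges = {}, mends = mends G\<rparr>)"

definition nontrivial_generic_component :: "('v, 'e) mgraph \<Rightarrow> ('v, 'e) mgraph \<Rightarrow> bool" where
  "nontrivial_generic_component G H \<longleftrightarrow>
     (\<exists>\<C>. connected_circuit_set G \<C> \<and>
        (\<forall>\<D>. connected_circuit_set G \<D> \<and> \<C> \<subseteq> \<D> \<longrightarrow> \<D> = \<C>) \<and>
        H = \<lparr>mverts = \<Union> (mverts ` \<C>), medges = \<Union> (medges ` \<C>), mends = mends G\<rparr>)"

definition generic_component :: "('v, 'e) mgraph \<Rightarrow> ('v, 'e) mgraph \<Rightarrow> bool" where
  "generic_component G H \<longleftrightarrow> trivial_generic_component G H \<or> nontrivial_generic_component G H"

definition external_edges :: "('v, 'e) mgraph \<Rightarrow> 'e set" where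
  "external_edges G = {e \<in> medges G. \<forall>H. circuit_of H G \<longrightarrow> e \<notin> medges H}"

section \<open>Branchings and good orderings\<close>

definition underlying :: "('v, 'e) pre_digraph \<Rightarrow> ('v, 'e) mgraph" where
  "underlying D = \<lparr>mverts = verts D, medges = arcs D, mends = (\<lambda>a. {tail D a, head D a})\<rparr>"

definition out_branching :: "('v, 'e) pre_digraph \<Rightarrow> 'v \<Rightarrow> ('v, 'e) pre_digraph \<Rightarrow> bool" where
  "out_branching D r B \<longleftrightarrow> spanning B D \<and> mg_spanning_tree (underlying B) (underlying D) \<and>
     r \<in> verts D \<and> in_degree B r = 0 \<and> (\<forall>v\<in>verts D. v \<noteq> r \<longrightarrow> in_degree B v = 1)"

definition in_branching :: "('v, 'e) pre_digraph \<Rightarrow> 'v \<Rightarrow> ('v, 'e) pre_digraph \<Rightarrow> bool" where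
  "in_branching D r B \<longleftrightarrow> spanning B D \<and> mg_spanning_tree (underlying B) (underlying D) \<and>
     r \<in> verts D \<and> out_degree B r = 0 \<and> (\<forall>v\<in>verts D. v \<noteq> r \<longrightarrow> out_degree B v = 1)"

definition vertex_ordering :: "('v, 'e) mgraph \<Rightarrow> 'v rel \<Rightarrow> bool" where
  "vertex_ordering G R \<longleftrightarrow> R \<subseteq> mverts G \<times> mverts G \<and> strict_linear_order_on (mverts G) R"

text \<open>Each edge keeps its identity as an arc, so that parallel edges become parallel arcs. The
  descriptions are unique for edges of \<open>G\<close> when \<open>R\<close> is a vertex ordering of \<open>G\<close>.\<close>

definition acyclic_orientation :: "('v, 'e) mgraph \<Rightarrow> 'v rel \<Rightarrow> ('v, 'e) pre_digraph" where
  "acyclic_orientation G R =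
     \<lparr>verts = mverts G, arcs = medges G,
      tail = (\<lambda>e. THE u. \<exists>v. mends G e = {u, v} \<and> (u, v) \<in> R),
      head = (\<lambda>e. THE v. \<exists>u. mends G e = {u, v} \<and> (u, v) \<in> R)\<rparr>"

definition good_ordering :: "('v, 'e) mgraph \<Rightarrow> 'v rel \<Rightarrow> bool" where
  "good_ordering G R \<longleftrightarrow> vertex_ordering G R \<and>
     (\<exists>r s B\<^sub>1 B\<^sub>2. out_branching (acyclic_orientation G R) r B\<^sub>1 \<and>
        in_branching (acyclic_orientation G R) s B\<^sub>2 \<and> arcs B\<^sub>1 \<inter> arcs B\<^sub>2 = {})"

end

theory Submission
  imports Defs
begin

text \<open>
  In an acyclic digraph, one entering arc for each vertex but the first always forms an out-branching,
  and one leaving arc for each vertex but the last always forms an in-branching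
  (\<open>parent_choice_tree\<close>). So an ordering is good if different edges can be assigned to all these
  demands, called slots below (\<open>saturating_order_good\<close>). This turns the problem into one about orders
  and assignments that can be built up by inserting vertices.

  The basic step inserts a block of vertices, ordered so that its own edges serve all its slots but an
  entering one at \<open>p\<close> and a leaving one at \<open>q\<close>, into a saturated order. Two edges from the block to
  distinct vertices \<open>x\<close>, \<open>y\<close> allow this: put the block between them (\<open>insert_block_deg_2\<close>). Three edges,
  to \<open>x\<close>, \<open>y\<close>, \<open>z\<close>, allow it even if an edge between \<open>x\<close> and \<open>y\<close> is deleted at the same time: two of
  the three edges thread the block, and the third takes over the slot that the deleted edge served
  (\<open>insert_block_deg_3\<close>). These are the reverses of the two reductions by which sparse graphs are
  taken apart.

  With single vertices as blocks this gives orders of generic circuits. A circuit without one edge is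
  a Laman graph, which has a vertex of degree two or three other than two given vertices \<open>s\<close> and \<open>t\<close>;
  removing it leaves a smaller Laman graph after at most one edge is added. Hence a generic circuit has
  a saturating order with arbitrary prescribed distinct ends \<open>s\<close> and \<open>t\<close> (\<open>circuit_threadable\<close>).

  In the theorem the generic circuits partition the vertex set (\<open>circuits_disjoint\<close>,
  \<open>circuits_cover\<close>). Contracting them yields a multigraph, formed by the external edges, with the
  counts of two edge-disjoint spanning trees (\<open>quotient_tight\<close>). It has a vertex of degree two or
  three, and it can be reduced there without violating the counts. The same insertion steps, now with
  whole circuits as blocks, build the order (\<open>block_order\<close>). This is where the matching enters: the
  two edges that thread a circuit end in different vertices of it, which can then be prescribed as
  its ends.
\<close>

section \<open>Saturating vertex orders\<close>

definition precedes :: "'v list \<Rightarrow> 'v \<Rightarrow> 'v \<Rightarrow> bool" where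
  "precedes vs u v \<longleftrightarrow> (\<exists>as bs. vs = as @ bs \<and> u \<in> set as \<and> v \<in> set bs)"

text \<open>
  The slot \<open>(v, True)\<close> asks for an edge that enters \<open>v\<close>, the slot \<open>(v, False)\<close> for an edge that
  leaves \<open>v\<close>, when every edge is directed from its earlier to its later end.
\<close>

definition serves :: "('e \<Rightarrow> 'v set) \<Rightarrow> 'v list \<Rightarrow> 'e \<Rightarrow> 'v \<times> bool \<Rightarrow> bool" where
  "serves d vs e p \<longleftrightarrow>
     (\<exists>u. d e = {u, fst p} \<and> (if snd p then precedes vs u (fst p) else precedes vs (fst p) u))"

text \<open>
  The order \<open>vs\<close> lets the edges of \<open>E\<close> serve all slots of \<open>S\<close>, with a different edge for each slot. In
  an acyclic digraph every choice of one entering arc for each vertex but the first is an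
  out-branching, so a good ordering is one that saturates all slots except an entering one at the
  first vertex and a leaving one at the last.
\<close>

definition saturates :: "('e \<Rightarrow> 'v set) \<Rightarrow> 'v list \<Rightarrow> 'e set \<Rightarrow> ('v \<times> bool) set \<Rightarrow> bool" where
  "saturates d vs E S \<longleftrightarrow> (\<exists>m. inj_on m S \<and> (\<forall>p\<in>S. m p \<in> E \<and> serves d vs (m p) p))"

text \<open>
  The set \<open>W\<close> can be ordered so that its own edges serve all its slots except the entering one of \<open>p\<close>
  and the leaving one of \<open>q\<close>. Such a block can be placed inside a larger order by one edge that comes
  into \<open>p\<close> from an earlier vertex and one that goes from \<open>q\<close> to a later vertex.
\<close>

definition threadable :: "('e \<Rightarrow> 'v set) \<Rightarrow> 'e set \<Rightarrow> 'v set \<Rightarrow> 'v \<Rightarrow> 'v \<Rightarrow> bool" where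
  "threadable d E W p q \<longleftrightarrow>
     (\<exists>ws. distinct ws \<and> set ws = W \<and> saturates d ws E (W \<times> UNIV - {(p, True), (q, False)}))"

lemma precedes_append: "u \<in> set as \<Longrightarrow> v \<in> set bs \<Longrightarrow> precedes (as @ bs) u v"
  unfolding precedes_def by blast

lemma precedes_insert: "precedes (as @ bs) u v \<Longrightarrow> precedes (as @ ws @ bs) u v"
proof -
  assume "precedes (as @ bs) u v"
  then obtain cs ds where c: "as @ bs = cs @ ds" "u \<in> set cs" "v \<in> set ds"
    unfolding precedes_def by blast
  from c(1) consider us where "as = cs @ us" "us @ bs = ds" | us where "as @ us = cs" "bs = us @ ds"
    unfolding append_eq_append_conv2 by blast
  then show ?thesis
  proof cases
    case 1
    then show ?thesis using c precedes_append[of u cs v "us @ ws @ bs"] by auto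
  next
    case 2
    then show ?thesis using c precedes_append[of u "as @ ws @ us" v ds] by auto
  qed
qed

lemma precedes_inner: "precedes ws u v \<Longrightarrow> precedes (as @ ws @ bs) u v"
proof -
  assume "precedes ws u v"
  then obtain cs ds where "ws = cs @ ds" "u \<in> set cs" "v \<in> set ds" unfolding precedes_def by blast
  then show ?thesis using precedes_append[of u "as @ cs" v "ds @ bs"] by simp
qed

lemma precedes_rev: "precedes (rev vs) u v \<longleftrightarrow> precedes vs v u"
proof -
  have "precedes (rev vs) u v" if "precedes vs v u" for vs and u v :: 'a
    using that precedes_append[of u "rev bs" v "rev as" for as bs] unfolding precedes_def by fastforce
  from this[of vs] this[of "rev vs"] show ?thesis by auto
qed

lemma precedes_in_set: "precedes vs u v \<Longrightarrow> u \<in> set vs \<and> v \<in> set vs"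
  unfolding precedes_def by auto

lemma precedes_irrefl: "distinct vs \<Longrightarrow> \<not> precedes vs u u"
  unfolding precedes_def by auto

lemma precedes_split:
  assumes "distinct (as @ x # bs)"
  shows "precedes (as @ x # bs) x y \<longleftrightarrow> y \<in> set bs"
proof
  assume "precedes (as @ x # bs) x y"
  then obtain cs ds where c: "as @ x # bs = cs @ ds" "x \<in> set cs" "y \<in> set ds"
    unfolding precedes_def by blast
  from c(1) consider us where "as = cs @ us" "us @ x # bs = ds"
    | us where "as @ us = cs" "x # bs = us @ ds"
    unfolding append_eq_append_conv2 by blast
  then show "y \<in> set bs"
    using c assms by cases (auto simp: Cons_eq_append_conv)
next
  assume "y \<in> set bs"
  then show "precedes (as @ x # bs) x y"
    using precedes_append[of x "as @ [x]" y bs] by simp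
qed

lemma precedes_total:
  assumes "x \<in> set vs" "y \<in> set vs" "x \<noteq> y"
  shows "precedes vs x y \<or> precedes vs y x"
proof -
  obtain as bs where vs: "vs = as @ x # bs" using assms(1) by (meson split_list)
  then have "y \<in> set as \<or> y \<in> set bs" using assms by auto
  then show ?thesis
    using vs precedes_append[of y as x "x # bs"] precedes_append[of x "as @ [x]" y bs] by auto
qed

lemma precedes_trans:
  assumes "distinct vs" "precedes vs u v" "precedes vs v w"
  shows "precedes vs u w"
proof -
  obtain as bs where vs: "vs = as @ v # bs" using assms(2) precedes_in_set by (metis split_list)
  have "w \<in> set bs" using assms precedes_split vs by metis
  moreover have "u \<in> set as"
    using assms vs precedes_split[of "rev bs" v "rev as" u] precedes_rev[of vs v u] by auto
  ultimately show ?thesis using vs precedes_append[of u as w "v # bs"] by auto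
qed

lemma precedes_hd: "distinct vs \<Longrightarrow> vs \<noteq> [] \<Longrightarrow> \<not> precedes vs u (hd vs)"
proof
  assume vs: "distinct vs" "vs \<noteq> []" and u: "precedes vs u (hd vs)"
  obtain w ws where ws: "vs = w # ws" using vs(2) by (cases vs) auto
  have "u \<noteq> w" using u ws precedes_irrefl[OF vs(1)] by auto
  moreover have "u \<in> set vs" using precedes_in_set[OF u] by simp
  ultimately have "precedes vs w u" using precedes_split[of "[]" w ws u] vs ws by simp
  then show False using precedes_trans[OF vs(1) _ u] precedes_irrefl[OF vs(1)] ws by auto
qed

lemma precedes_last: "distinct vs \<Longrightarrow> vs \<noteq> [] \<Longrightarrow> \<not> precedes vs (last vs) u"
  using precedes_hd[of "rev vs" u] by (simp add: hd_rev precedes_rev)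

lemma saturates_mono:
  assumes "saturates d vs E S" "E \<subseteq> E'" "S' \<subseteq> S" "\<And>u v. precedes vs u v \<Longrightarrow> precedes vs' u v"
  shows "saturates d vs' E' S'"
proof -
  obtain m where "inj_on m S" "\<forall>p\<in>S. m p \<in> E \<and> serves d vs (m p) p"
    using assms(1) unfolding saturates_def by blast
  moreover have "serves d vs' e p" if "serves d vs e p" for e p
    using that assms(4) unfolding serves_def by (cases "snd p") auto
  ultimately have "inj_on m S'" "\<forall>p\<in>S'. m p \<in> E' \<and> serves d vs' (m p) p"
    using assms(2,3) by (auto intro: inj_on_subset)
  then show ?thesis unfolding saturates_def by blast
qed

lemma saturates_cong:
  assumes "saturates d vs E S" "\<And>e. e \<in> E \<Longrightarrow> d' e = d e"
  shows "saturates d' vs E S"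
proof -
  obtain m where "inj_on m S" "\<forall>p\<in>S. m p \<in> E \<and> serves d vs (m p) p"
    using assms(1) unfolding saturates_def by blast
  then have "\<forall>p\<in>S. m p \<in> E \<and> serves d' vs (m p) p"
    using assms(2) unfolding serves_def by simp
  then show ?thesis using \<open>inj_on m S\<close> unfolding saturates_def by blast
qed

lemma saturates_Un:
  assumes "saturates d vs E S" "saturates d vs E' S'" "E \<inter> E' = {}"
  shows "saturates d vs (E \<union> E') (S \<union> S')"
proof -
  obtain m where m: "inj_on m S" "\<forall>p\<in>S. m p \<in> E \<and> serves d vs (m p) p"
    using assms(1) unfolding saturates_def by blast
  obtain n where n: "inj_on n S'" "\<forall>p\<in>S'. n p \<in> E' \<and> serves d vs (n p) p"
    using assms(2) unfolding saturates_def by blast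
  let ?k = "\<lambda>p. if p \<in> S then m p else n p"
  have "inj_on ?k (S \<union> S')"
  proof (rule inj_onI)
    fix p q assume pq: "p \<in> S \<union> S'" "q \<in> S \<union> S'" "?k p = ?k q"
    have mn: "m p' \<noteq> n q'" if "p' \<in> S" "q' \<in> S'" for p' q'
      using m(2) n(2) that assms(3) by (metis IntI empty_iff)
    show "p = q"
    proof (cases "p \<in> S \<longleftrightarrow> q \<in> S")
      case True
      then show ?thesis using pq inj_onD[OF m(1)] inj_onD[OF n(1)] by (metis Un_iff)
    next
      case False
      then show ?thesis using pq mn[of p q] mn[of q p] by (metis Un_iff)
    qed
  qed
  moreover have "\<forall>p\<in>S \<union> S'. ?k p \<in> E \<union> E' \<and> serves d vs (?k p) p" using m n by auto
  ultimately show ?thesis unfolding saturates_def by blast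
qed

lemma saturates_entering:
  assumes "d e = {u, v}" "precedes vs u v"
  shows "saturates d vs {e} {(v, True)}"
  unfolding saturates_def serves_def using assms by (intro exI[of _ "\<lambda>_. e"]) auto

lemma saturates_leaving:
  assumes "d e = {u, v}" "precedes vs v u"
  shows "saturates d vs {e} {(v, False)}"
  unfolding saturates_def serves_def using assms by (intro exI[of _ "\<lambda>_. e"]) auto

lemma saturates_empty: "saturates d vs E {}"
  unfolding saturates_def by auto

lemma saturates_rev:
  assumes "saturates d vs E S"
  shows "saturates d (rev vs) E (map_prod id Not ` S)"
proof -
  obtain m where m: "inj_on m S" "\<forall>p\<in>S. m p \<in> E \<and> serves d vs (m p) p"
    using assms unfolding saturates_def by blast
  let ?f = "map_prod id Not :: 'b \<times> bool \<Rightarrow> _"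
  have ff: "?f (?f p) = p" for p by (cases p) simp
  have "inj_on (m \<circ> ?f) (?f ` S)"
    using m(1) ff unfolding inj_on_def by force
  moreover have "\<forall>p\<in>?f ` S. (m \<circ> ?f) p \<in> E \<and> serves d (rev vs) ((m \<circ> ?f) p) p"
    using m(2) by (force simp: serves_def precedes_rev split: if_splits)
  ultimately show ?thesis unfolding saturates_def by blast
qed

text \<open>
  Reversing an order exchanges entering and leaving slots.
\<close>

lemma threadable_sym:
  assumes "threadable d E W p q"
  shows "threadable d E W q p"
proof -
  obtain ws where ws: "distinct ws" "set ws = W"
    "saturates d ws E (W \<times> UNIV - {(p, True), (q, False)})"
    using assms unfolding threadable_def by blast
  have "map_prod id Not ` (W \<times> UNIV - {(p, True), (q, False)}) = W \<times> UNIV - {(q, True), (p, False)}"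
  proof -
    have "(v, b) \<in> map_prod id Not ` A \<longleftrightarrow> (v, \<not> b) \<in> A" for v b and A :: "('b \<times> bool) set"
      by (force simp: image_iff)
    then show ?thesis by auto
  qed
  then show ?thesis
    using saturates_rev[OF ws(3)] ws(1,2) unfolding threadable_def by (intro exI[of _ "rev ws"]) auto
qed

lemma threadable_singleton: "threadable d {} {v} v v"
proof -
  have "{v} \<times> UNIV - {(v, True), (v, False)} = {}" by auto
  then have "saturates d [v] {} ({v} \<times> UNIV - {(v, True), (v, False)})"
    by (simp only: saturates_empty)
  then show ?thesis unfolding threadable_def by (intro exI[of _ "[v]"]) simp
qed

text \<open>
  An edge can only serve the entering slot of its later end or the leaving slot of its earlier end,
  and it serves at most one of them. Deleting it therefore loses one of two known slots.
\<close>

lemma saturates_remove_edge: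
  assumes "saturates d vs (insert f E) S" "d f = {x, y}" "precedes vs x y" "distinct vs"
  shows "saturates d vs E (S - {(y, True)}) \<or> saturates d vs E (S - {(x, False)})"
proof -
  obtain m where m: "inj_on m S" "\<forall>p\<in>S. m p \<in> insert f E \<and> serves d vs (m p) p"
    using assms(1) unfolding saturates_def by blast
  have nyx: "\<not> precedes vs y x" using assms(3,4) precedes_trans precedes_irrefl by metis
  have only: "p = (y, True) \<or> p = (x, False)" if "p \<in> S" "m p = f" for p
  proof -
    have "serves d vs f p" using m that by auto
    then show ?thesis using assms nyx precedes_irrefl[OF assms(4)]
      unfolding serves_def by (cases p) (auto simp: doubleton_eq_iff split: if_splits)
  qed
  have use: "saturates d vs E (S - {p})" if "\<forall>q\<in>S - {p}. m q \<noteq> f" for p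
    unfolding saturates_def using m that by (intro exI[of _ m]) (auto intro: inj_on_subset)
  show ?thesis
  proof (cases "(y, True) \<in> S \<and> m (y, True) = f")
    case True
    then have "\<forall>q\<in>S - {(y, True)}. m q \<noteq> f" using m(1) by (auto simp: inj_on_def)
    then show ?thesis using use by blast
  next
    case False
    then have "\<forall>q\<in>S - {(x, False)}. m q \<noteq> f" using only by blast
    then show ?thesis using use by blast
  qed
qed

section \<open>Inserting a block of vertices\<close>

lemma splice_block:
  assumes vs: "saturates d (as @ bs) E S" and u: "u \<in> set as" and w: "w \<in> set bs"
    and e: "d e = {u, p}" "d f = {w, q}" "e \<noteq> f"
    and W: "threadable d F W p q" "p \<in> W" "q \<in> W"
    and disj: "E \<inter> F = {}" "e \<notin> E \<union> F" "f \<notin> E \<union> F"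
  shows "\<exists>ws. distinct ws \<and> set ws = W \<and>
    saturates d (as @ ws @ bs) (E \<union> F \<union> {e, f}) (S \<union> W \<times> UNIV)"
proof -
  obtain ws where ws: "distinct ws" "set ws = W"
    "saturates d ws F (W \<times> UNIV - {(p, True), (q, False)})"
    using W unfolding threadable_def by blast
  let ?vs = "as @ ws @ bs"
  have 1: "saturates d ?vs E S"
    by (rule saturates_mono[OF vs]) (auto intro: precedes_insert)
  have 2: "saturates d ?vs F (W \<times> UNIV - {(p, True), (q, False)})"
    by (rule saturates_mono[OF ws(3)]) (auto intro: precedes_inner)
  have 3: "saturates d ?vs {e} {(p, True)}"
    using e(1) by (rule saturates_entering) (use u W ws in \<open>auto intro: precedes_append\<close>)
  have 4: "saturates d ?vs {f} {(q, False)}"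
    using e(2) by (rule saturates_leaving)
      (use w W ws precedes_append[of q "as @ ws" w bs] in auto)
  have "saturates d ?vs (((E \<union> F) \<union> {e}) \<union> {f})
    (((S \<union> (W \<times> UNIV - {(p, True), (q, False)})) \<union> {(p, True)}) \<union> {(q, False)})"
    using disj e(3) by (intro saturates_Un 1 2 3 4) auto
  then have "saturates d ?vs (E \<union> F \<union> {e, f}) (S \<union> W \<times> UNIV)"
    by (rule saturates_mono) auto
  then show ?thesis using ws by blast
qed

text \<open>
  The block goes between \<open>x\<close> and \<open>y\<close>, whichever of them is earlier.
\<close>

lemma insert_block_deg_2:
  assumes vs: "distinct vs" "saturates d vs E S" and xy: "x \<in> set vs" "y \<in> set vs" "x \<noteq> y"
    and e: "d e = {x, a}" "d f = {y, b}" "e \<noteq> f"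
    and W: "threadable d F W a b" "a \<in> W" "b \<in> W" "W \<inter> set vs = {}"
    and disj: "E \<inter> F = {}" "e \<notin> E \<union> F" "f \<notin> E \<union> F"
  shows "\<exists>vs'. distinct vs' \<and> set vs' = set vs \<union> W \<and>
    saturates d vs' (E \<union> F \<union> {e, f}) (S \<union> W \<times> UNIV)"
proof -
  have *: "\<exists>vs'. distinct vs' \<and> set vs' = set vs \<union> W \<and>
      saturates d vs' (E \<union> F \<union> {e, f}) (S \<union> W \<times> UNIV)"
    if pre: "precedes vs x y" and e: "d e = {x, a}" "d f = {y, b}" "e \<noteq> f"
    and W: "threadable d F W a b" "a \<in> W" "b \<in> W"
    and disj: "e \<notin> E \<union> F" "f \<notin> E \<union> F" for x y a b e f
  proof -
    obtain as bs where s: "vs = as @ bs" "x \<in> set as" "y \<in> set bs"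
      using pre unfolding precedes_def by blast
    obtain ws where "distinct ws" "set ws = W"
      "saturates d (as @ ws @ bs) (E \<union> F \<union> {e, f}) (S \<union> W \<times> UNIV)"
      using splice_block[OF vs(2)[unfolded s(1)] s(2,3) e W assms(13) disj] by blast
    then show ?thesis using vs(1) s(1) assms(12)
      by (intro exI[of _ "as @ ws @ bs"]) auto
  qed
  from precedes_total[OF xy] show ?thesis
  proof
    assume "precedes vs x y"
    from *[OF this e W(1-3) disj(2,3)] show ?thesis .
  next
    assume "precedes vs y x"
    from *[OF this e(2,1) e(3)[symmetric] threadable_sym[OF W(1)] W(3,2) disj(3,2)]
    show ?thesis by (simp add: insert_commute)
  qed
qed

text \<open>
  The slot \<open>(y, True)\<close> has lost its edge from \<open>x\<close> to \<open>y\<close>, and the new block has to serve it. The block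
  is threaded between \<open>x\<close> and \<open>z\<close>, and it is placed next to \<open>x\<close>: directly behind \<open>x\<close> if \<open>x\<close> is earlier
  than \<open>z\<close>, and directly in front of \<open>x\<close> otherwise. In both cases all of the block is earlier than \<open>y\<close>,
  so the third edge enters \<open>y\<close>.
\<close>

lemma insert_block_deg_3_entering:
  assumes vs: "distinct vs" "saturates d vs E (S - {(y, True)})"
    and xyz: "precedes vs x y" "z \<in> set vs" "x \<noteq> z"
    and e: "d e\<^sub>1 = {x, a}" "d e\<^sub>2 = {y, b}" "d e\<^sub>3 = {z, c}" "distinct [e\<^sub>1, e\<^sub>2, e\<^sub>3]"
    and W: "threadable d F W a c" "a \<in> W" "b \<in> W" "c \<in> W" "W \<inter> set vs = {}"
    and disj: "E \<inter> F = {}" "{e\<^sub>1, e\<^sub>2, e\<^sub>3} \<inter> (E \<union> F) = {}"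
  shows "\<exists>vs'. distinct vs' \<and> set vs' = set vs \<union> W \<and>
    saturates d vs' (E \<union> F \<union> {e\<^sub>1, e\<^sub>2, e\<^sub>3}) (S \<union> W \<times> UNIV)"
proof -
  obtain as bs where s: "vs = as @ x # bs" using precedes_in_set[OF xyz(1)] by (meson split_list)
  have y: "y \<in> set bs" using xyz(1) vs(1) precedes_split unfolding s by metis
  \<comment> \<open>In either position the block lies before \<open>y\<close>, so \<open>e\<^sub>2\<close> enters \<open>y\<close>.\<close>
  have finish: ?thesis
    if "distinct ws" "set ws = W" "vs = as' @ bs'" "y \<in> set bs'"
      "saturates d (as' @ ws @ bs') (E \<union> F \<union> {e\<^sub>1, e\<^sub>3}) ((S - {(y, True)}) \<union> W \<times> UNIV)"
    for as' bs' ws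
  proof -
    let ?vs = "as' @ ws @ bs'"
    have "saturates d ?vs {e\<^sub>2} {(y, True)}"
      using e(2) that(2,4) W(3) precedes_append[of b "as' @ ws" y bs']
      by (intro saturates_entering[of d e\<^sub>2 b]) (auto simp: insert_commute)
    from saturates_Un[OF that(5) this]
    have "saturates d ?vs (E \<union> F \<union> {e\<^sub>1, e\<^sub>3} \<union> {e\<^sub>2}) (S - {(y, True)} \<union> W \<times> UNIV \<union> {(y, True)})"
      using disj e(4) by auto
    then have "saturates d ?vs (E \<union> F \<union> {e\<^sub>1, e\<^sub>2, e\<^sub>3}) (S \<union> W \<times> UNIV)"
      by (rule saturates_mono) auto
    then show ?thesis using that vs(1) W(5) by (intro exI[of _ ?vs]) auto
  qed
  consider "z \<in> set bs" | "z \<in> set as" using xyz s by auto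
  then show ?thesis
  proof cases
    case 1
    have "saturates d ((as @ [x]) @ bs) E (S - {(y, True)})" using vs(2) s by simp
    from splice_block[OF this _ 1 e(1,3) _ W(1,2,4) disj(1)] e(4) disj(2)
    obtain ws where "distinct ws" "set ws = W"
      "saturates d ((as @ [x]) @ ws @ bs) (E \<union> F \<union> {e\<^sub>1, e\<^sub>3}) (S - {(y, True)} \<union> W \<times> UNIV)"
      by auto
    then show ?thesis using finish[of ws "as @ [x]" bs] s y by simp
  next
    case 2
    from splice_block[OF vs(2)[unfolded s] 2 _ e(3,1) _ threadable_sym[OF W(1)] W(4,2) disj(1)]
      e(4) disj(2)
    obtain ws where "distinct ws" "set ws = W"
      "saturates d (as @ ws @ x # bs) (E \<union> F \<union> {e\<^sub>3, e\<^sub>1}) (S - {(y, True)} \<union> W \<times> UNIV)"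
      by auto
    then show ?thesis using finish[of ws as "x # bs"] s y by (simp add: insert_commute)
  qed
qed

text \<open>
  The mirror image under reversal of the order: now the edge from \<open>x\<close> to \<open>y\<close> served \<open>(x, False)\<close>.
\<close>

lemma insert_block_deg_3_leaving:
  fixes vs :: "'v list"
  assumes vs: "distinct vs" "saturates d vs E (S - {(x, False)})"
    and xyz: "precedes vs x y" "z \<in> set vs" "y \<noteq> z"
    and e: "d e\<^sub>1 = {x, a}" "d e\<^sub>2 = {y, b}" "d e\<^sub>3 = {z, c}" "distinct [e\<^sub>1, e\<^sub>2, e\<^sub>3]"
    and W: "threadable d F W b c" "a \<in> W" "b \<in> W" "c \<in> W" "W \<inter> set vs = {}"
    and disj: "E \<inter> F = {}" "{e\<^sub>1, e\<^sub>2, e\<^sub>3} \<inter> (E \<union> F) = {}"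
  shows "\<exists>vs'. distinct vs' \<and> set vs' = set vs \<union> W \<and>
    saturates d vs' (E \<union> F \<union> {e\<^sub>1, e\<^sub>2, e\<^sub>3}) (S \<union> W \<times> UNIV)"
proof -
  let ?f = "map_prod id Not :: 'v \<times> bool \<Rightarrow> 'v \<times> bool"
  have mem: "(v, k) \<in> ?f ` A \<longleftrightarrow> (v, \<not> k) \<in> A" for v k A
    by (force simp: image_iff)
  have "?f ` (S - {(x, False)}) = ?f ` S - {(x, True)}"
    using mem by auto
  with saturates_rev[OF vs(2)] have "saturates d (rev vs) E (?f ` S - {(x, True)})" by simp
  from insert_block_deg_3_entering[OF _ this _ _ xyz(3) e(2,1,3) _ W(1,3,2,4) _ disj(1)]
  obtain vs' where vs': "distinct vs'" "set vs' = set vs \<union> W"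
    "saturates d vs' (E \<union> F \<union> {e\<^sub>2, e\<^sub>1, e\<^sub>3}) (?f ` S \<union> W \<times> UNIV)"
    using vs(1) xyz(1,2) e(4) W(5) disj(2) by (auto simp: precedes_rev)
  have "?f ` (?f ` S \<union> W \<times> UNIV) = S \<union> W \<times> UNIV"
    using mem by auto
  with saturates_rev[OF vs'(3)] vs'(1,2) show ?thesis
    by (intro exI[of _ "rev vs'"]) (simp add: insert_commute)
qed

text \<open>
  The inverse of the reduction that deletes a block joined to the rest by three edges and adds an edge
  \<open>f\<close> between two of the neighbours. The ends of \<open>f\<close> are given by a second end function \<open>d'\<close>, so that
  \<open>f\<close> may be one of the three edges with changed ends; in this way no fresh edge is ever needed.
\<close>

lemma insert_block_deg_3:
  assumes vs: "distinct vs" "saturates d' vs (insert f E) S"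
    and d': "d' f = {x, y}" "\<And>e. e \<in> E \<Longrightarrow> d' e = d e"
    and xyz: "{x, y, z} \<subseteq> set vs" "x \<noteq> y" "y \<noteq> z" "x \<noteq> z"
    and e: "d e\<^sub>1 = {x, a}" "d e\<^sub>2 = {y, b}" "d e\<^sub>3 = {z, c}" "distinct [e\<^sub>1, e\<^sub>2, e\<^sub>3]"
    and W: "threadable d F W a c" "threadable d F W b c" "{a, b, c} \<subseteq> W" "W \<inter> set vs = {}"
    and disj: "E \<inter> F = {}" "{e\<^sub>1, e\<^sub>2, e\<^sub>3} \<inter> (E \<union> F) = {}"
  shows "\<exists>vs'. distinct vs' \<and> set vs' = set vs \<union> W \<and>
    saturates d vs' (E \<union> F \<union> {e\<^sub>1, e\<^sub>2, e\<^sub>3}) (S \<union> W \<times> UNIV)"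
proof -
  have *: "\<exists>vs'. distinct vs' \<and> set vs' = set vs \<union> W \<and>
      saturates d vs' (E \<union> F \<union> {e\<^sub>1, e\<^sub>2, e\<^sub>3}) (S \<union> W \<times> UNIV)"
    if pre: "precedes vs x y" and d'f: "d' f = {x, y}" and ne: "x \<noteq> z" "y \<noteq> z"
      and e: "d e\<^sub>1 = {x, a}" "d e\<^sub>2 = {y, b}" "distinct [e\<^sub>1, e\<^sub>2, e\<^sub>3]"
      and W': "threadable d F W a c" "threadable d F W b c" "a \<in> W" "b \<in> W"
      and disj': "{e\<^sub>1, e\<^sub>2, e\<^sub>3} \<inter> (E \<union> F) = {}" for x y a b e\<^sub>1 e\<^sub>2
  proof -
    have z: "z \<in> set vs" and c: "c \<in> W" using xyz W(3) by auto
    from saturates_remove_edge[OF vs(2) d'f pre vs(1)] show ?thesis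
    proof
      assume "saturates d' vs E (S - {(y, True)})"
      then have "saturates d vs E (S - {(y, True)})"
        by (rule saturates_cong) (simp add: d'(2))
      from insert_block_deg_3_entering[OF vs(1) this pre z ne(1) e(1,2) assms(11) e(3) W'(1,3,4) c
          W(4) disj(1) disj'] show ?thesis .
    next
      assume "saturates d' vs E (S - {(x, False)})"
      then have "saturates d vs E (S - {(x, False)})"
        by (rule saturates_cong) (simp add: d'(2))
      from insert_block_deg_3_leaving[OF vs(1) this pre z ne(2) e(1,2) assms(11) e(3) W'(2,3,4) c
          W(4) disj(1) disj'] show ?thesis .
    qed
  qed
  have "precedes vs x y \<or> precedes vs y x" using xyz by (intro precedes_total) auto
  then show ?thesis
  proof
    assume "precedes vs x y"
    from *[OF this d'(1) xyz(4,3) e(1,2,4) W(1,2) _ _ disj(2)] W(3) show ?thesis by simp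
  next
    assume "precedes vs y x"
    from *[OF this _ xyz(3,4) e(2,1) _ W(2,1)] d'(1) e(4) W(3) disj(2)
    have "\<exists>vs'. distinct vs' \<and> set vs' = set vs \<union> W \<and>
      saturates d vs' (E \<union> F \<union> {e\<^sub>2, e\<^sub>1, e\<^sub>3}) (S \<union> W \<times> UNIV)"
      by (auto simp: insert_commute)
    then show ?thesis by (simp add: insert_commute)
  qed
qed

section \<open>Sparse and tight multigraphs\<close>

definition inside :: "('e \<Rightarrow> 'v set) \<Rightarrow> 'e set \<Rightarrow> 'v set \<Rightarrow> 'e set" where
  "inside d E X = {e \<in> E. d e \<subseteq> X}"

definition star :: "('e \<Rightarrow> 'v set) \<Rightarrow> 'e set \<Rightarrow> 'v \<Rightarrow> 'e set" where
  "star d E v = {e \<in> E. v \<in> d e}"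

text \<open>
  The bound \<open>2 * card X - l\<close> is imposed on sets with at least \<open>l - 1\<close> vertices: for \<open>l = 2\<close> on nonempty
  sets, which is the count of two edge-disjoint forests, and for \<open>l = 3\<close> on sets with at least two
  vertices, which is Laman's count.
\<close>

definition sparse :: "nat \<Rightarrow> ('e \<Rightarrow> 'v set) \<Rightarrow> 'e set \<Rightarrow> 'v set \<Rightarrow> bool" where
  "sparse l d E V \<longleftrightarrow> (\<forall>X\<subseteq>V. l \<le> card X + 1 \<longrightarrow> card (inside d E X) + l \<le> 2 * card X)"

definition tight :: "nat \<Rightarrow> ('e \<Rightarrow> 'v set) \<Rightarrow> 'e set \<Rightarrow> 'v set \<Rightarrow> bool" where
  "tight l d E V \<longleftrightarrow> finite V \<and> finite E \<and> (\<forall>e\<in>E. d e \<subseteq> V \<and> card (d e) = 2) \<and>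
     sparse l d E V \<and> card E + l = 2 * card V"

text \<open>
  A new edge between \<open>x\<close> and \<open>y\<close> preserves sparsity exactly if no set that attains the bound contains
  both of them.
\<close>

definition addable :: "nat \<Rightarrow> ('e \<Rightarrow> 'v set) \<Rightarrow> 'e set \<Rightarrow> 'v set \<Rightarrow> 'v \<Rightarrow> 'v \<Rightarrow> bool" where
  "addable l d E V x y \<longleftrightarrow> (\<forall>X\<subseteq>V. x \<in> X \<and> y \<in> X \<and> l \<le> card X + 1 \<longrightarrow>
     card (inside d E X) + l < 2 * card X)"

lemma tightD:
  assumes "tight l d E V"
  shows "finite V" "finite E" "\<And>e. e \<in> E \<Longrightarrow> d e \<subseteq> V" "\<And>e. e \<in> E \<Longrightarrow> card (d e) = 2"
    "sparse l d E V" "card E + l = 2 * card V"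
  using assms unfolding tight_def by auto

lemma sparseD: "sparse l d E V \<Longrightarrow> X \<subseteq> V \<Longrightarrow> l \<le> card X + 1 \<Longrightarrow> card (inside d E X) + l \<le> 2 * card X"
  unfolding sparse_def by blast

lemma inside_finite: "finite E \<Longrightarrow> finite (inside d E X)"
  unfolding inside_def by auto

lemma tight_cong:
  assumes "tight l d E V" "\<And>e. e \<in> E \<Longrightarrow> d' e = d e"
  shows "tight l d' E V"
proof -
  have "inside d' E X = inside d E X" for X using assms(2) unfolding inside_def by auto
  then show ?thesis using assms unfolding tight_def sparse_def by auto
qed

text \<open>
  Edges inside \<open>A\<close> or \<open>B\<close> are inside the union, and those inside both are inside the intersection.
\<close>

lemma inside_supermodular:
  assumes "finite E"
  shows "card (inside d E A) + card (inside d E B) \<le> card (inside d E (A \<union> B)) + card (inside d E (A \<inter> B))"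
proof -
  have "inside d E A \<inter> inside d E B = inside d E (A \<inter> B)" unfolding inside_def by auto
  moreover have "card (inside d E A \<union> inside d E B) \<le> card (inside d E (A \<union> B))"
    by (rule card_mono) (auto simp: inside_def assms)
  ultimately show ?thesis
    using card_Un_Int[of "inside d E A" "inside d E B"] assms by (simp add: inside_finite)
qed

lemma sum_card_star:
  assumes "finite V" "finite E" "\<And>e. e \<in> E \<Longrightarrow> d e \<subseteq> V" "\<And>e. e \<in> E \<Longrightarrow> card (d e) = 2"
  shows "(\<Sum>v\<in>V. card (star d E v)) = 2 * card E"
proof -
  have "card {v \<in> V. v \<in> d e} = 2" if "e \<in> E" for e
  proof -
    have "{v \<in> V. v \<in> d e} = d e" using assms(3) that by auto
    then show ?thesis using assms(4) that by simp
  qed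
  then have "(\<Sum>v\<in>V. card {e \<in> E. v \<in> d e}) = 2 * card E"
    by (intro sum_multicount) (use assms in auto)
  then show ?thesis unfolding star_def .
qed

lemma inside_remove:
  assumes "X \<subseteq> V - {v}"
  shows "inside d (E - star d E v) X = inside d E X"
  using assms unfolding inside_def star_def by auto

lemma inside_delete:
  assumes "tight l d E V"
  shows "inside d E (V - {v}) = E - star d E v"
  using assms unfolding inside_def star_def tight_def by auto

lemma card_star_ge_2:
  assumes "tight l d E V" "v \<in> V" "l \<le> card V"
  shows "2 \<le> card (star d E v)"
proof -
  note t = tightD[OF assms(1)]
  have c: "card (V - {v}) = card V - 1" using assms t by simp
  have "card (E - star d E v) + l \<le> 2 * card (V - {v})"
    unfolding inside_delete[OF assms(1), symmetric]
    by (rule sparseD[OF t(5)]) (use c assms(3) in auto)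
  moreover have "card (E - star d E v) = card E - card (star d E v)"
    by (rule card_Diff_subset) (auto simp: star_def t(2))
  moreover have "card V > 0" using assms t card_gt_0_iff by blast
  ultimately show ?thesis using t(6) c by linarith
qed

lemma star_neighbour:
  assumes "tight l d E V" "e \<in> star d E v"
  obtains x where "d e = {v, x}" "x \<in> V" "x \<noteq> v"
proof -
  have e: "e \<in> E" "v \<in> d e" using assms(2) unfolding star_def by auto
  then obtain a b where ab: "d e = {a, b}" "a \<noteq> b" using tightD(4)[OF assms(1)] by (meson card_2_iff)
  have "d e \<subseteq> V" using tightD(3)[OF assms(1)] e by blast
  then show ?thesis using that[of a] that[of b] ab e(2) by auto
qed

lemma tight_delete_deg_2:
  assumes "tight l d E V" "v \<in> V" "card (star d E v) = 2"
  shows "tight l d (E - star d E v) (V - {v})"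
proof -
  note t = tightD[OF assms(1)]
  have "card (E - star d E v) = card E - card (star d E v)"
    by (rule card_Diff_subset) (auto simp: star_def t(2))
  moreover have "card (star d E v) \<le> card E" by (rule card_mono) (auto simp: star_def t(2))
  moreover have "card V > 0" using assms t card_gt_0_iff by blast
  moreover have "card (V - {v}) = card V - 1" using assms t by simp
  ultimately have "card (E - star d E v) + l = 2 * card (V - {v})" using t(6) assms(3) by linarith
  moreover have "sparse l d (E - star d E v) (V - {v})"
    unfolding sparse_def using inside_remove sparseD[OF t(5)]
    by (metis Diff_subset subset_trans)
  ultimately show ?thesis unfolding tight_def using t by (auto simp: star_def)
qed

text \<open>
  The reduction at a vertex of degree three. The new edge reuses the label \<open>e\<^sub>1\<close> of a deleted one.
\<close>

lemma tight_reduce_deg_3: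
  assumes "tight l d E V" "v \<in> V" "star d E v = {e\<^sub>1, e\<^sub>2, e\<^sub>3}" "distinct [e\<^sub>1, e\<^sub>2, e\<^sub>3]"
    and xy: "x \<in> V - {v}" "y \<in> V - {v}" "x \<noteq> y" and add: "addable l d (E - star d E v) (V - {v}) x y"
  shows "tight l (d(e\<^sub>1 := {x, y})) (insert e\<^sub>1 (E - star d E v)) (V - {v})"
proof -
  note t = tightD[OF assms(1)]
  let ?E = "E - star d E v" and ?d = "d(e\<^sub>1 := {x, y})"
  have fin: "finite ?E" using t by simp
  have e1: "e\<^sub>1 \<notin> ?E" "e\<^sub>1 \<in> E" using assms(3) unfolding star_def by auto
  have "card ?E = card E - card (star d E v)"
    by (rule card_Diff_subset) (auto simp: star_def t(2))
  moreover have "card (star d E v) \<le> card E" by (rule card_mono) (auto simp: star_def t(2))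
  moreover have "card (star d E v) = 3" using assms(3,4) by simp
  moreover have "card V > 0" using assms t card_gt_0_iff by blast
  moreover have "card (V - {v}) = card V - 1" using assms t by simp
  moreover have "card (insert e\<^sub>1 ?E) = Suc (card ?E)" using e1 fin by simp
  ultimately have "card (insert e\<^sub>1 ?E) + l = 2 * card (V - {v})" using t(6) by linarith
  moreover have "sparse l ?d (insert e\<^sub>1 ?E) (V - {v})"
    unfolding sparse_def
  proof (intro allI impI)
    fix X assume X: "X \<subseteq> V - {v}" "l \<le> card X + 1"
    show "card (inside ?d (insert e\<^sub>1 ?E) X) + l \<le> 2 * card X"
    proof (cases "{x, y} \<subseteq> X")
      case True
      have "inside ?d (insert e\<^sub>1 ?E) X \<subseteq> insert e\<^sub>1 (inside d ?E X)" unfolding inside_def by auto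
      then have "card (inside ?d (insert e\<^sub>1 ?E) X) \<le> card (insert e\<^sub>1 (inside d ?E X))"
        using fin by (intro card_mono) (simp_all add: inside_finite)
      also have "\<dots> \<le> Suc (card (inside d ?E X))" by (metis card_insert_le_m1 diff_Suc_1 le_refl zero_less_Suc)
      finally have "card (inside ?d (insert e\<^sub>1 ?E) X) \<le> Suc (card (inside d ?E X))" .
      moreover have "card (inside d ?E X) + l < 2 * card X"
        using add True X unfolding addable_def by simp
      ultimately show ?thesis by linarith
    next
      case False
      then have "inside ?d (insert e\<^sub>1 ?E) X = inside d ?E X" using e1 unfolding inside_def by auto
      also have "\<dots> = inside d E X" using inside_remove[OF X(1)] .
      finally have "inside ?d (insert e\<^sub>1 ?E) X = inside d E X" .
      then show ?thesis using sparseD[OF t(5), of X] X by auto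
    qed
  qed
  moreover have "\<forall>e\<in>insert e\<^sub>1 ?E. ?d e \<subseteq> V - {v} \<and> card (?d e) = 2"
    using t(3,4) xy unfolding star_def by auto
  ultimately show ?thesis unfolding tight_def using t(1) fin by auto
qed

text \<open>
  A set that contains all neighbours of a vertex of degree three cannot attain the bound, because the
  vertex would add only one to the size but three to the number of edges.
\<close>

lemma sparse_three_edges:
  assumes "tight l d E V" "v \<in> V" "card (star d E v) = 3" "\<And>e. e \<in> star d E v \<Longrightarrow> d e \<subseteq> insert v X"
    "X \<subseteq> V - {v}" "l \<le> card X + 1"
  shows "card (inside d (E - star d E v) X) + l < 2 * card X"
proof -
  note t = tightD[OF assms(1)]
  have fX: "finite X" "v \<notin> X" using assms(5) t(1) by (auto intro: finite_subset)
  have "inside d (E - star d E v) X \<union> star d E v \<subseteq> inside d E (insert v X)"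
    using assms(4) unfolding inside_def star_def by auto
  then have "card (inside d (E - star d E v) X \<union> star d E v) \<le> card (inside d E (insert v X))"
    by (intro card_mono) (auto simp: inside_finite t(2))
  moreover have "card (inside d (E - star d E v) X \<union> star d E v) = card (inside d (E - star d E v) X) + 3"
    using assms(3) t(2) by (subst card_Un_disjoint) (auto simp: inside_def star_def)
  moreover have "card (inside d E (insert v X)) + l \<le> 2 * card (insert v X)"
    by (rule sparseD[OF t(5)]) (use assms(2,5,6) fX in auto)
  ultimately show ?thesis using fX by auto
qed

text \<open>
  If both pairs were blocked, the two tight sets that block them would share \<open>y\<close>, hence have a tight
  union, and this union would contain all neighbours of \<open>v\<close>. A pair \<open>x = y\<close> counts as blocked, by the
  singleton \<open>{x}\<close>, so the neighbours need not be distinct.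
\<close>

lemma addable_pair_2:
  assumes t: "tight 2 d E V" and v: "v \<in> V" and s: "card (star d E v) = 3"
    and xyz: "\<And>e. e \<in> star d E v \<Longrightarrow> d e \<subseteq> {v, x, y, z}"
  shows "addable 2 d (E - star d E v) (V - {v}) x y \<or> addable 2 d (E - star d E v) (V - {v}) y z"
proof (rule ccontr)
  let ?E = "E - star d E v"
  assume "\<not> ?thesis"
  then obtain A B where A: "A \<subseteq> V - {v}" "x \<in> A" "y \<in> A" "2 * card A \<le> card (inside d ?E A) + 2"
    and B: "B \<subseteq> V - {v}" "y \<in> B" "z \<in> B" "2 * card B \<le> card (inside d ?E B) + 2"
    unfolding addable_def not_less[symmetric] by blast
  note t' = tightD[OF t]
  have f: "finite A" "finite B" using A B t'(1) by (auto intro: finite_subset)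
  have "card (A \<inter> B) > 0" "card (A \<union> B) > 0" using A B f by (auto simp: card_gt_0_iff)
  then have "card (inside d ?E (A \<inter> B)) + 2 \<le> 2 * card (A \<inter> B)"
    using sparseD[OF t'(5), of "A \<inter> B"] inside_remove[of "A \<inter> B" V v d E] A(1)
    by (simp add: le_infI1 subset_Diff_insert)
  moreover have "card (inside d ?E (A \<union> B)) + 2 < 2 * card (A \<union> B)"
    using \<open>card (A \<union> B) > 0\<close> xyz A B by (intro sparse_three_edges[OF t v s]) auto
  moreover have "card (inside d ?E A) + card (inside d ?E B) \<le>
    card (inside d ?E (A \<union> B)) + card (inside d ?E (A \<inter> B))"
    using t'(2) by (intro inside_supermodular) auto
  moreover have "card A + card B = card (A \<union> B) + card (A \<inter> B)" using f by (rule card_Un_Int)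
  ultimately show False using A(4) B(4) by linarith
qed

text \<open>
  Three blocking sets meet pairwise in single vertices, since otherwise the union of two of them would
  be tight and contain all neighbours of \<open>v\<close>. Their edge sets are then disjoint, and counting shows
  that the union of all three is tight, with the same contradiction.
\<close>

lemma addable_pair_3:
  assumes t: "tight 3 d E V" and v: "v \<in> V" and s: "card (star d E v) = 3"
    and xyz: "\<And>e. e \<in> star d E v \<Longrightarrow> d e \<subseteq> {v, x, y, z}" and ne: "x \<noteq> y" "y \<noteq> z" "x \<noteq> z"
  shows "addable 3 d (E - star d E v) (V - {v}) x y \<or> addable 3 d (E - star d E v) (V - {v}) y z \<or>
    addable 3 d (E - star d E v) (V - {v}) x z"
proof (rule ccontr)
  let ?E = "E - star d E v" and ?i = "\<lambda>X. card (inside d (E - star d E v) X)"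
  assume "\<not> ?thesis"
  then obtain A B C where A: "A \<subseteq> V - {v}" "x \<in> A" "y \<in> A" "2 * card A \<le> ?i A + 3"
    and B: "B \<subseteq> V - {v}" "y \<in> B" "z \<in> B" "2 * card B \<le> ?i B + 3"
    and C: "C \<subseteq> V - {v}" "x \<in> C" "z \<in> C" "2 * card C \<le> ?i C + 3"
    unfolding addable_def not_less[symmetric] by blast
  note t' = tightD[OF t]
  have two: "2 \<le> card X" if "X \<subseteq> V - {v}" "p \<in> X" "q \<in> X" "p \<noteq> q" for X p q
    using card_mono[of X "{p, q}"] that t'(1) finite_subset[of X "V - {v}"] by simp
  have big: "?i X + 3 < 2 * card X" if "X \<subseteq> V - {v}" "x \<in> X" "y \<in> X" "z \<in> X" for X
  proof (rule sparse_three_edges[OF t v s _ that(1)])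
    show "3 \<le> card X + 1" using two[OF that(1-3) ne(1)] by simp
    show "d e \<subseteq> insert v X" if "e \<in> star d E v" for e
      using xyz[OF that] \<open>x \<in> X\<close> \<open>y \<in> X\<close> \<open>z \<in> X\<close> by blast
  qed
  have sp: "?i X + 3 \<le> 2 * card X" if "X \<subseteq> V - {v}" "2 \<le> card X" for X
  proof -
    have "X \<subseteq> V" using that(1) by blast
    then show ?thesis using sparseD[OF t'(5), of X] inside_remove[OF that(1), of d E] that(2) by simp
  qed
  have sup: "?i X + ?i Y \<le> ?i (X \<union> Y) + ?i (X \<inter> Y)" "card X + card Y = card (X \<union> Y) + card (X \<inter> Y)"
    if "X \<subseteq> V - {v}" "Y \<subseteq> V - {v}" for X Y
  proof -
    have "finite X" "finite Y" using that t'(1) finite_subset[of _ "V - {v}"] by auto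
    then show "card X + card Y = card (X \<union> Y) + card (X \<inter> Y)" by (rule card_Un_Int)
    show "?i X + ?i Y \<le> ?i (X \<union> Y) + ?i (X \<inter> Y)"
      using t'(2) by (intro inside_supermodular) simp
  qed
  have meet: "card (X \<inter> Y) = 1 \<and> ?i (X \<inter> Y) = 0"
    if "X \<subseteq> V - {v}" "Y \<subseteq> V - {v}" "2 * card X \<le> ?i X + 3" "2 * card Y \<le> ?i Y + 3"
      "X \<inter> Y \<noteq> {}" "{x, y, z} \<subseteq> X \<union> Y" for X Y
  proof -
    have f: "finite (X \<inter> Y)" using that(1) t'(1) finite_subset[of X "V - {v}"] by simp
    have "?i (X \<union> Y) + 3 < 2 * card (X \<union> Y)" by (rule big) (use that in auto)
    moreover have "?i (X \<inter> Y) + 3 \<le> 2 * card (X \<inter> Y)" if "2 \<le> card (X \<inter> Y)"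
      by (rule sp) (use that \<open>X \<subseteq> V - {v}\<close> in auto)
    ultimately have "\<not> 2 \<le> card (X \<inter> Y)"
      using sup[OF that(1,2)] that(3,4) by linarith
    moreover have "card (X \<inter> Y) \<noteq> 0" using that(5) f by simp
    ultimately have "card (X \<inter> Y) = 1" by linarith
    moreover have "inside d ?E (X \<inter> Y) = {}"
    proof (rule ccontr)
      assume "inside d ?E (X \<inter> Y) \<noteq> {}"
      then obtain e where e: "e \<in> E" "d e \<subseteq> X \<inter> Y" unfolding inside_def by auto
      show False using card_mono[OF f e(2)] t'(4)[OF e(1)] \<open>card (X \<inter> Y) = 1\<close> by simp
    qed
    ultimately show ?thesis by simp
  qed
  have AB: "card (A \<inter> B) = 1 \<and> ?i (A \<inter> B) = 0" by (rule meet) (use A B in auto)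
  have AC: "card (A \<inter> C) = 1 \<and> ?i (A \<inter> C) = 0" by (rule meet) (use A C in auto)
  have BC: "card (B \<inter> C) = 1 \<and> ?i (B \<inter> C) = 0" by (rule meet) (use B C in auto)
  have "(A \<union> B) \<inter> C = {x, z}"
  proof -
    have "A \<inter> C = {x}" using AC A(2) C(2) by (metis IntI card_1_singletonE singletonD)
    moreover have "B \<inter> C = {z}" using BC B(3) C(3) by (metis IntI card_1_singletonE singletonD)
    ultimately show ?thesis by auto
  qed
  then have "card (A \<union> B) + card C = card (A \<union> B \<union> C) + 2"
    using sup(2)[of "A \<union> B" C] A(1) B(1) C(1) ne by simp
  moreover have "card A + card B = card (A \<union> B) + 1" using sup(2)[OF A(1) B(1)] AB by simp
  moreover have "?i A + ?i B + ?i C \<le> ?i (A \<union> B \<union> C)"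
  proof -
    have fin: "finite (inside d ?E X)" for X using t'(2) by (simp add: inside_finite)
    have int: "inside d ?E X \<inter> inside d ?E Y = inside d ?E (X \<inter> Y)" for X Y
      unfolding inside_def by auto
    have disj: "inside d ?E A \<inter> inside d ?E B = {}" "inside d ?E A \<inter> inside d ?E C = {}"
      "inside d ?E B \<inter> inside d ?E C = {}"
      using AB AC BC fin unfolding int by auto
    have "?i A + ?i B + ?i C = card (inside d ?E A \<union> inside d ?E B \<union> inside d ?E C)"
      using disj fin by (simp add: card_Un_disjoint Int_Un_distrib2)
    also have "\<dots> \<le> ?i (A \<union> B \<union> C)"
      using fin by (intro card_mono) (auto simp: inside_def)
    finally show ?thesis .
  qed
  moreover have "?i (A \<union> B \<union> C) + 3 < 2 * card (A \<union> B \<union> C)" using A B C by (intro big) auto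
  moreover note A(4) B(4) C(4)
  ultimately show False by linarith
qed

section \<open>Laman graphs and generic circuits\<close>

text \<open>
  The degrees sum to \<open>4 * card V - 6\<close>. If all vertices other than \<open>s\<close> and \<open>t\<close> had degree at least four,
  at most two would be left for \<open>s\<close> and \<open>t\<close> together, but each of them has degree at least two.
\<close>

lemma laman_low_degree_vertex:
  assumes t: "tight 3 d E V" and V: "3 \<le> card V" and st: "s \<in> V" "t \<in> V" "s \<noteq> t"
  obtains v where "v \<in> V" "v \<noteq> s" "v \<noteq> t" "card (star d E v) = 2 \<or> card (star d E v) = 3"
proof -
  note t' = tightD[OF t]
  have ge: "2 \<le> card (star d E v)" if "v \<in> V" for v using card_star_ge_2[OF t that V] .
  have "\<exists>v\<in>V - {s, t}. card (star d E v) \<le> 3"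
  proof (rule ccontr)
    assume "\<not> ?thesis"
    then have "(\<Sum>v\<in>V - {s, t}. 4) \<le> (\<Sum>v\<in>V - {s, t}. card (star d E v))"
      by (intro sum_mono) force
    moreover have "card (V - {s, t}) = card V - 2" using st t'(1) by (simp add: card_Diff_subset)
    moreover have "(\<Sum>v\<in>V. card (star d E v)) =
        (\<Sum>v\<in>V - {s, t}. card (star d E v)) + (\<Sum>v\<in>{s, t}. card (star d E v))"
      using st t'(1) by (intro sum.subset_diff) auto
    moreover have "(\<Sum>v\<in>{s, t}. card (star d E v)) \<ge> 4"
      using ge[OF st(1)] ge[OF st(2)] st(3) by simp
    moreover have "(\<Sum>v\<in>V. card (star d E v)) = 2 * card E" by (rule sum_card_star) (use t' in auto)
    ultimately show False using t'(6) V by simp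
  qed
  then obtain v where v: "v \<in> V" "v \<noteq> s" "v \<noteq> t" "card (star d E v) \<le> 3" by blast
  then show ?thesis using that[of v] ge[of v] by (auto simp: le_Suc_eq numeral_3_eq_3)
qed

lemma laman_no_parallel_edges:
  assumes t: "tight 3 d E V" and e: "e \<in> E" "f \<in> E" "e \<noteq> f"
  shows "d e \<noteq> d f"
proof
  assume eq: "d e = d f"
  note t' = tightD[OF t]
  have "{e, f} \<subseteq> inside d E (d e)" using e eq unfolding inside_def by auto
  then have "card {e, f} \<le> card (inside d E (d e))"
    by (intro card_mono) (simp_all add: inside_finite t'(2))
  moreover have "card (inside d E (d e)) + 3 \<le> 2 * card (d e)"
    by (rule sparseD[OF t'(5)]) (use t'(3,4) e in auto)
  ultimately show False using e t'(4)[OF e(1)] by simp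
qed

text \<open>
  Induction by Laman reductions, always at a vertex other than \<open>s\<close> and \<open>t\<close>. The number of edges,
  \<open>2 * card V - 3\<close>, is exactly the number of slots. The slot \<open>(s, False)\<close> is given up so that the
  counts match; when the graph comes from a generic circuit, the deleted edge will serve it.
\<close>

theorem laman_order:
  fixes d :: "'e \<Rightarrow> 'v set"
  assumes "tight 3 d E V" "s \<in> V" "t \<in> V" "s \<noteq> t"
  shows "\<exists>vs. distinct vs \<and> set vs = V \<and>
    saturates d vs E (V \<times> UNIV - {(s, True), (s, False), (t, False)})"
  using assms
proof (induction "card V" arbitrary: V E d rule: less_induct)
  case less
  note t = less.prems(1) and t' = tightD[OF less.prems(1)]
  have sub: "{s, t} \<subseteq> V" using less.prems by simp
  have "card {s, t} \<le> card V" by (rule card_mono) (use sub t'(1) in auto)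
  then have V2: "2 \<le> card V" using less.prems(4) by simp
  let ?S = "{(s, True), (s, False), (t, False)}"
  have ext: "(V - {v}) \<times> UNIV - ?S \<union> {v} \<times> UNIV = V \<times> UNIV - ?S" if "v \<in> V" "v \<noteq> s" "v \<noteq> t" for v
    using that by auto
  show ?case
  proof (cases "card V = 2")
    case True
    then have V: "V = {s, t}" using sub less.prems(4) t'(1) by (metis card_2_iff card_subset_eq)
    have "card E = 1" using t'(6) True by simp
    then obtain e where e: "E = {e}" by (meson card_1_singletonE)
    then have "d e = {s, t}" using t'(1,3,4) True V by (metis card_subset_eq insertI1)
    then have "saturates d [s, t] E {(t, True)}"
      unfolding e using precedes_append[of s "[s]" t "[t]"] by (intro saturates_entering) auto
    moreover have "V \<times> UNIV - ?S = {(t, True)}" using V less.prems(4) by auto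
    ultimately show ?thesis using V less.prems(4) by (intro exI[of _ "[s, t]"]) simp
  next
    case False
    then have V3: "3 \<le> card V" using V2 by simp
    obtain v where v: "v \<in> V" "v \<noteq> s" "v \<noteq> t" and deg: "card (star d E v) = 2 \<or> card (star d E v) = 3"
      using laman_low_degree_vertex[OF t V3 less.prems(2-4)] by blast
    let ?E = "E - star d E v"
    have sE: "star d E v \<subseteq> E" unfolding star_def by auto
    have less': "card (V - {v}) < card V" using v(1) t'(1) by (metis card_Diff1_less)
    have W: "threadable d {} {v} v v" by (rule threadable_singleton)
    have IH: "\<exists>vs. distinct vs \<and> set vs = V - {v} \<and> saturates d' vs E' ((V - {v}) \<times> UNIV - ?S)"
      if "tight 3 d' E' (V - {v})" for d' :: "'e \<Rightarrow> 'v set" and E'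
      using less.hyps[OF less' that] less.prems v by blast
    from deg show ?thesis
    proof
      assume c2: "card (star d E v) = 2"
      then obtain e f where ef: "star d E v = {e, f}" "e \<noteq> f" by (meson card_2_iff)
      obtain x where x: "d e = {v, x}" "x \<in> V" "x \<noteq> v" using star_neighbour[OF t] ef by blast
      obtain y where y: "d f = {v, y}" "y \<in> V" "y \<noteq> v" using star_neighbour[OF t] ef by blast
      have xy: "x \<noteq> y" using laman_no_parallel_edges[OF t, of e f] sE ef x y by auto
      obtain vs where vs: "distinct vs" "set vs = V - {v}" "saturates d vs ?E ((V - {v}) \<times> UNIV - ?S)"
        using IH[OF tight_delete_deg_2[OF t v(1) c2]] by blast
      from insert_block_deg_2[OF vs(1,3), of x y e v f v "{}" "{v}"] vs(2) x y xy ef W v(1)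
      obtain vs' where "distinct vs'" "set vs' = V"
        "saturates d vs' (?E \<union> {e, f}) ((V - {v}) \<times> UNIV - ?S \<union> {v} \<times> UNIV)"
        by (auto simp: insert_commute insert_absorb)
      moreover have "?E \<union> {e, f} = E" using ef sE by auto
      ultimately show ?thesis using ext[OF v] by auto
    next
      assume c3: "card (star d E v) = 3"
      then obtain e\<^sub>1 e\<^sub>2 e\<^sub>3 where st3: "star d E v = {e\<^sub>1, e\<^sub>2, e\<^sub>3}" "distinct [e\<^sub>1, e\<^sub>2, e\<^sub>3]"
        by (auto simp: card_3_iff)
      have step: ?thesis
        if st3: "star d E v = {e\<^sub>1, e\<^sub>2, e\<^sub>3}" "distinct [e\<^sub>1, e\<^sub>2, e\<^sub>3]"
          and x: "d e\<^sub>1 = {v, x}" "x \<in> V" "x \<noteq> v" and y: "d e\<^sub>2 = {v, y}" "y \<in> V" "y \<noteq> v"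
          and z: "d e\<^sub>3 = {v, z}" "z \<in> V" "z \<noteq> v" and ne: "x \<noteq> y" "y \<noteq> z" "x \<noteq> z"
          and add: "addable 3 d ?E (V - {v}) x y"
        for e\<^sub>1 e\<^sub>2 e\<^sub>3 x y z
      proof -
        let ?d = "d(e\<^sub>1 := {x, y})"
        have e1: "e\<^sub>1 \<notin> ?E" using st3 by simp
        have "tight 3 ?d (insert e\<^sub>1 ?E) (V - {v})"
          by (rule tight_reduce_deg_3[OF t v(1) st3 _ _ ne(1) add]) (use x y in auto)
        then obtain vs where vs: "distinct vs" "set vs = V - {v}"
          "saturates ?d vs (insert e\<^sub>1 ?E) ((V - {v}) \<times> UNIV - ?S)"
          using IH by blast
        have "\<exists>vs'. distinct vs' \<and> set vs' = set vs \<union> {v} \<and>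
          saturates d vs' (?E \<union> {} \<union> {e\<^sub>1, e\<^sub>2, e\<^sub>3}) ((V - {v}) \<times> UNIV - ?S \<union> {v} \<times> UNIV)"
          by (rule insert_block_deg_3[OF vs(1,3), of x y d z e\<^sub>1 v e\<^sub>2 v e\<^sub>3 v])
            (use e1 x y z ne st3 vs(2) W in \<open>auto simp: insert_commute\<close>)
        moreover have "?E \<union> {} \<union> {e\<^sub>1, e\<^sub>2, e\<^sub>3} = E" using st3 sE by auto
        ultimately show ?thesis using ext[OF v] vs(2) v(1) by (auto simp: insert_absorb)
      qed
      obtain x where x: "d e\<^sub>1 = {v, x}" "x \<in> V" "x \<noteq> v" using star_neighbour[OF t] st3 by blast
      obtain y where y: "d e\<^sub>2 = {v, y}" "y \<in> V" "y \<noteq> v" using star_neighbour[OF t] st3 by blast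
      obtain z where z: "d e\<^sub>3 = {v, z}" "z \<in> V" "z \<noteq> v" using star_neighbour[OF t] st3 by blast
      have e: "e\<^sub>1 \<in> E" "e\<^sub>2 \<in> E" "e\<^sub>3 \<in> E" using st3 sE by auto
      have ne: "x \<noteq> y" "y \<noteq> z" "x \<noteq> z"
        using laman_no_parallel_edges[OF t e(1,2)] laman_no_parallel_edges[OF t e(2,3)]
          laman_no_parallel_edges[OF t e(1,3)] st3(2) x(1) y(1) z(1) by auto
      have "d e \<subseteq> {v, x, y, z}" if "e \<in> star d E v" for e using that st3 x y z by auto
      from addable_pair_3[OF t v(1) c3 this ne] consider "addable 3 d ?E (V - {v}) x y"
        | "addable 3 d ?E (V - {v}) y z" | "addable 3 d ?E (V - {v}) x z" by blast
      then show ?thesis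
      proof cases
        case 1
        show ?thesis by (rule step[OF st3 x y z ne 1])
      next
        case 2
        show ?thesis
          by (rule step[OF _ _ y z x ne(2) ne(3)[symmetric] ne(1)[symmetric] 2]) (use st3 in auto)
      next
        case 3
        show ?thesis
          by (rule step[OF _ _ x z y ne(3) ne(2)[symmetric] ne(1) 3]) (use st3 in auto)
      qed
    qed
  qed
qed

text \<open>
  The first vertex of the list has no entering edge, so it must be \<open>s\<close>.
\<close>

lemma saturates_first:
  assumes "distinct vs" "s \<in> set vs" "saturates d vs E S" "\<And>v. v \<in> set vs \<Longrightarrow> v \<noteq> s \<Longrightarrow> (v, True) \<in> S"
    "v \<in> set vs" "v \<noteq> s"
  shows "precedes vs s v"
proof -
  obtain w ws where ws: "vs = w # ws" using assms(2) by (cases vs) auto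
  have "w = s"
  proof (rule ccontr)
    assume "w \<noteq> s"
    then have "(w, True) \<in> S" using assms(4) ws by auto
    then obtain u where "precedes vs u w" using assms(3) unfolding saturates_def serves_def by fastforce
    then show False using precedes_hd[of vs u] assms(1) ws by simp
  qed
  then show ?thesis using precedes_split[of "[]" w ws v] assms ws by auto
qed

text \<open>
  Every vertex of a generic circuit can be prescribed as the first, and every other one as the last.
  Deleting an edge \<open>e\<close> at \<open>s\<close> leaves a Laman graph, and since \<open>s\<close> comes first in the order of that
  graph, \<open>e\<close> leaves \<open>s\<close> whatever its other end is.
\<close>

theorem circuit_threadable:
  assumes fin: "finite V" "finite E" and E: "\<And>e. e \<in> E \<Longrightarrow> d e \<subseteq> V \<and> card (d e) = 2"
    and count: "card E + 2 = 2 * card V"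
    and sp: "\<And>X. X \<subset> V \<Longrightarrow> 2 \<le> card X \<Longrightarrow> card (inside d E X) + 3 \<le> 2 * card X"
    and st: "s \<in> V" "t \<in> V" "s \<noteq> t"
  shows "threadable d E V s t"
proof -
  have "\<exists>e\<in>E. s \<in> d e"
  proof (rule ccontr)
    assume "\<not> ?thesis"
    then have all: "inside d E (V - {s}) = E" using E unfolding inside_def by blast
    have c: "card (V - {s}) = card V - 1" using st fin by simp
    have "card {s, t} \<le> card V" using st fin by (intro card_mono) auto
    then have V2: "2 \<le> card V" using st by simp
    show False
    proof (cases "card V = 2")
      case True
      have "card E \<noteq> 0" using count True by simp
      then obtain e where e: "e \<in> E" by fastforce
      then have "d e \<subseteq> V - {s}" using all unfolding inside_def by blast
      then have "card (d e) \<le> 1" using card_mono[of "V - {s}"] fin c True by fastforce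
      then show False using E[OF e] by simp
    next
      case False
      then have "card (inside d E (V - {s})) + 3 \<le> 2 * card (V - {s})"
        using st V2 c by (intro sp) auto
      then show False using all count c V2 by simp
    qed
  qed
  then obtain e where e: "e \<in> E" "s \<in> d e" by blast
  then obtain w where w: "d e = {w, s}" "w \<noteq> s" "w \<in> V"
    using E[OF e(1)] by (auto simp: card_2_iff doubleton_eq_iff)
  let ?E = "E - {e}"
  have "tight 3 d ?E V"
  proof -
    have "card ?E + 1 = card E" using e fin by (metis Suc_eq_plus1 card.remove)
    moreover have "card (inside d ?E X) + 3 \<le> 2 * card X" if "X \<subseteq> V" "3 \<le> card X + 1" for X
    proof (cases "X = V")
      case True
      have "inside d ?E V = ?E" using E unfolding inside_def by auto
      then show ?thesis using True count calculation by simp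
    next
      case False
      have "card (inside d ?E X) \<le> card (inside d E X)"
        using fin by (intro card_mono) (auto simp: inside_def)
      moreover have "card (inside d E X) + 3 \<le> 2 * card X" using False that by (intro sp) auto
      ultimately show ?thesis by linarith
    qed
    ultimately show ?thesis using fin E count unfolding tight_def sparse_def by auto
  qed
  from laman_order[OF this st] obtain vs where vs: "distinct vs" "set vs = V"
    "saturates d vs ?E (V \<times> UNIV - {(s, True), (s, False), (t, False)})" by blast
  have "precedes vs s w"
    by (rule saturates_first[OF vs(1) _ vs(3)]) (use vs st w in auto)
  then have "saturates d vs {e} {(s, False)}" using w(1) by (intro saturates_leaving)
  from saturates_Un[OF vs(3) this]
  have "saturates d vs E (V \<times> UNIV - {(s, True), (t, False)})"
    by (rule saturates_mono) (use e in auto)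
  then show ?thesis unfolding threadable_def using vs by blast
qed

section \<open>Blocks joined by a matching\<close>

text \<open>
  The ends of an edge in the quotient graph whose vertices are the blocks.
\<close>

definition blocks_met :: "'v set set \<Rightarrow> ('e \<Rightarrow> 'v set) \<Rightarrow> 'e \<Rightarrow> 'v set set" where
  "blocks_met \<P> d e = {P \<in> \<P>. P \<inter> d e \<noteq> {}}"

lemma tight_2_low_degree_vertex:
  assumes t: "tight 2 d E V" and V: "2 \<le> card V"
  obtains v where "v \<in> V" "card (star d E v) = 2 \<or> card (star d E v) = 3"
proof -
  note t' = tightD[OF t]
  have "\<exists>v\<in>V. card (star d E v) \<le> 3"
  proof (rule ccontr)
    assume "\<not> ?thesis"
    then have "(\<Sum>v\<in>V. 4) \<le> (\<Sum>v\<in>V. card (star d E v))"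
      by (intro sum_mono) force
    moreover have "(\<Sum>v\<in>V. card (star d E v)) = 2 * card E" by (rule sum_card_star) (use t' in auto)
    ultimately show False using t'(6) by simp
  qed
  then obtain v where v: "v \<in> V" "card (star d E v) \<le> 3" by blast
  then show ?thesis using that[of v] card_star_ge_2[OF t v(1) V] by (auto simp: le_Suc_eq numeral_3_eq_3)
qed

lemma blocks_met_edge:
  assumes "disjoint \<P>" "P \<in> \<P>" "Q \<in> \<P>" "a \<in> P" "x \<in> Q" "d e = {a, x}"
  shows "blocks_met \<P> d e = {P, Q}"
proof -
  have "R = S" if "R \<in> \<P>" "S \<in> \<P>" "z \<in> R" "z \<in> S" for R S z
    using assms(1) that unfolding disjoint_def by blast
  then have "R = P \<longleftrightarrow> a \<in> R" "R = Q \<longleftrightarrow> x \<in> R" if "R \<in> \<P>" for R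
    using that assms(2-5) by metis+
  moreover have "R \<inter> d e \<noteq> {} \<longleftrightarrow> a \<in> R \<or> x \<in> R" for R
    using assms(6) by auto
  ultimately show ?thesis using assms(2,3) unfolding blocks_met_def by auto
qed

lemma star_block_edge:
  assumes "tight 2 (blocks_met \<P> d) M \<P>" "disjoint \<P>" "P \<in> \<P>"
    and M: "\<And>e. e \<in> M \<Longrightarrow> d e \<subseteq> \<Union>\<P> \<and> card (d e) = 2"
    and e: "e \<in> star (blocks_met \<P> d) M P"
  shows "\<exists>x a Q. d e = {x, a} \<and> a \<in> P \<and> x \<in> Q \<and> Q \<in> \<P> \<and> Q \<noteq> P \<and> blocks_met \<P> d e = {P, Q}"
proof -
  have eM: "e \<in> M" "P \<inter> d e \<noteq> {}" using e unfolding star_def blocks_met_def by auto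
  then obtain a where a: "a \<in> P" "a \<in> d e" by blast
  then obtain x where x: "d e = {a, x}" using M[OF eM(1)] by (auto simp: card_2_iff doubleton_eq_iff)
  then obtain Q where Q: "Q \<in> \<P>" "x \<in> Q" using M[OF eM(1)] by auto
  have b: "blocks_met \<P> d e = {P, Q}" by (rule blocks_met_edge[of \<P> P Q a x]) (use assms a x Q in auto)
  moreover have "card (blocks_met \<P> d e) = 2" using tightD(4)[OF assms(1) eM(1)] .
  ultimately have "Q \<noteq> P" by auto
  moreover have "d e = {x, a}" using x by (simp add: insert_commute)
  ultimately show ?thesis using a(1) Q b by blast
qed

text \<open>
  Induction on the number of blocks, by deleting a block that meets at most three of the joining
  edges. Because these edges form a matching, they reach the block in distinct vertices, so the block
  can be threaded between any two of them, and they reach distinct vertices outside, so the degree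
  two and degree three insertions apply. After the reduction of a block with three joining edges the
  remaining edges are again a matching, since the new edge joins two vertices that have just lost
  theirs.
\<close>

theorem block_order:
  fixes d :: "'e \<Rightarrow> 'v set"
  assumes "tight 2 (blocks_met \<P> d) M \<P>" "disjoint \<P>"
    and "\<And>e. e \<in> M \<Longrightarrow> d e \<subseteq> \<Union>\<P> \<and> card (d e) = 2"
    and "\<And>e f. e \<in> M \<Longrightarrow> f \<in> M \<Longrightarrow> e \<noteq> f \<Longrightarrow> d e \<inter> d f = {}"
    and "\<And>P. P \<in> \<P> \<Longrightarrow> \<exists>p\<in>P. \<exists>q\<in>P. p \<noteq> q"
    and "\<And>P p q. P \<in> \<P> \<Longrightarrow> p \<in> P \<Longrightarrow> q \<in> P \<Longrightarrow> p \<noteq> q \<Longrightarrow> threadable d (I P) P p q"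
    and "\<And>P. P \<in> \<P> \<Longrightarrow> I P \<inter> M = {}"
    and "\<And>P Q. P \<in> \<P> \<Longrightarrow> Q \<in> \<P> \<Longrightarrow> P \<noteq> Q \<Longrightarrow> I P \<inter> I Q = {}"
  shows "\<exists>vs s t. distinct vs \<and> set vs = \<Union>\<P> \<and>
    saturates d vs (M \<union> \<Union>(I ` \<P>)) (\<Union>\<P> \<times> UNIV - {(s, True), (t, False)})"
  using assms
proof (induction "card \<P>" arbitrary: \<P> M d rule: less_induct)
  case less
  note t = less.prems(1) and dis = less.prems(2) and M = less.prems(3) and match = less.prems(4)
    and two = less.prems(5) and thr = less.prems(6) and IM = less.prems(7) and II = less.prems(8)
  note t' = tightD[OF t]
  let ?b = "blocks_met \<P> d"
  show ?case
  proof (cases "2 \<le> card \<P>")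
    case False
    then have "card \<P> = 1" "card M = 0" using t'(6) by auto
    then obtain P where P: "\<P> = {P}" and M0: "M = {}" using t'(2) by (auto simp: card_1_singleton_iff)
    obtain p q where pq: "p \<in> P" "q \<in> P" "p \<noteq> q" using two[of P] P by blast
    have "threadable d (I P) P p q" using thr[of P p q] P pq by blast
    then show ?thesis unfolding threadable_def using P M0 by auto
  next
    case True
    then obtain P where P: "P \<in> \<P>" and deg: "card (star ?b M P) = 2 \<or> card (star ?b M P) = 3"
      using tight_2_low_degree_vertex[OF t] by blast
    let ?Q = "\<P> - {P}" and ?M = "M - star ?b M P"
    have less': "card ?Q < card \<P>" using P t'(1) by (metis card_Diff1_less)
    have sM: "star ?b M P \<subseteq> M" unfolding star_def by auto
    have UQ: "\<Union>\<P> = \<Union>?Q \<union> P" and PQ: "P \<inter> \<Union>?Q = {}"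
      using P dis unfolding disjoint_def by auto
    have inQ: "d e \<subseteq> \<Union>?Q" and bQ: "blocks_met ?Q d e = ?b e" if "e \<in> ?M" for e
    proof -
      have "P \<inter> d e = {}" using that P unfolding star_def blocks_met_def by auto
      then show "d e \<subseteq> \<Union>?Q" "blocks_met ?Q d e = ?b e" using that M[of e] UQ unfolding blocks_met_def by auto
    qed
    define E where "E = ?M \<union> \<Union>(I ` ?Q)"
    have EI: "E \<inter> I P = {}" using IM[OF P] II[OF _ P] P unfolding E_def by fastforce
    have starE: "star ?b M P \<inter> (E \<union> I P) = {}"
      using IM sM P unfolding E_def by fastforce
    have allE: "E \<union> I P \<union> star ?b M P = M \<union> \<Union>(I ` \<P>)" using sM P unfolding E_def by auto
    have slots: "(\<Union>?Q \<times> UNIV - {(s, True), (t, False)}) \<union> P \<times> UNIV \<supseteq>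
        \<Union>\<P> \<times> UNIV - {(s, True), (t, False)}" for s t
      using UQ by auto
    have finish: ?thesis
      if "distinct vs'" "set vs' = \<Union>?Q \<union> P"
        "saturates d vs' (E \<union> I P \<union> star ?b M P) ((\<Union>?Q \<times> UNIV - {(s, True), (t, False)}) \<union> P \<times> UNIV)"
      for vs' s t
      using that UQ saturates_mono[OF that(3) _ slots, of "M \<union> \<Union>(I ` \<P>)" vs'] allE
      by (intro exI[of _ vs'] exI[of _ s] exI[of _ t]) simp
    have disQ: "disjoint ?Q" using dis unfolding disjoint_def by auto
    have nb: "\<exists>x a X. d e = {x, a} \<and> a \<in> P \<and> x \<in> X \<and> X \<in> \<P> \<and> X \<noteq> P \<and> ?b e = {P, X}"
      if "e \<in> star ?b M P" for e
      by (rule star_block_edge[OF t dis P M that])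
    from deg show ?thesis
    proof
      assume c2: "card (star ?b M P) = 2"
      then obtain e f where ef: "star ?b M P = {e, f}" "e \<noteq> f" by (meson card_2_iff)
      obtain x a X where x: "d e = {x, a}" "a \<in> P" "x \<in> X" "X \<in> \<P>" "X \<noteq> P"
        using nb[of e] ef(1) by auto
      obtain y b Y where y: "d f = {y, b}" "b \<in> P" "y \<in> Y" "Y \<in> \<P>" "Y \<noteq> P"
        using nb[of f] ef(1) by auto
      have "d e \<inter> d f = {}" using match[of e f] sM ef by blast
      then have ne: "x \<noteq> y" "a \<noteq> b" using x y by auto
      have "tight 2 ?b ?M ?Q" by (rule tight_delete_deg_2[OF t P c2])
      then have "tight 2 (blocks_met ?Q d) ?M ?Q" by (rule tight_cong) (rule bQ)
      note tQ = this
      obtain vs s t where vs: "distinct vs" "set vs = \<Union>?Q"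
        "saturates d vs E (\<Union>?Q \<times> UNIV - {(s, True), (t, False)})"
      proof (atomize_elim, unfold E_def, rule less.hyps[OF less' tQ disQ])
        show "d e \<subseteq> \<Union>?Q \<and> card (d e) = 2" if "e \<in> ?M" for e using inQ[OF that] M[of e] that by blast
        show "d e \<inter> d f = {}" if "e \<in> ?M" "f \<in> ?M" "e \<noteq> f" for e f using match[of e f] that by blast
        show "\<exists>p\<in>R. \<exists>q\<in>R. p \<noteq> q" if "R \<in> ?Q" for R using two[of R] that by blast
        show "threadable d (I R) R p q" if "R \<in> ?Q" "p \<in> R" "q \<in> R" "p \<noteq> q" for R p q
          using thr[of R p q] that by blast
        show "I R \<inter> ?M = {}" if "R \<in> ?Q" for R using IM[of R] that by blast
        show "I R \<inter> I R' = {}" if "R \<in> ?Q" "R' \<in> ?Q" "R \<noteq> R'" for R R' using II[of R R'] that by blast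
      qed
      have "\<exists>vs'. distinct vs' \<and> set vs' = set vs \<union> P \<and>
        saturates d vs' (E \<union> I P \<union> {e, f}) ((\<Union>?Q \<times> UNIV - {(s, True), (t, False)}) \<union> P \<times> UNIV)"
        by (rule insert_block_deg_2[OF vs(1,3), of x y e a f b])
          (use x y ne ef thr[OF P] vs(2) PQ EI starE in auto)
      then show ?thesis using finish vs(2) ef(1) by metis
    next
      assume c3: "card (star ?b M P) = 3"
      then obtain e\<^sub>1 e\<^sub>2 e\<^sub>3 where st3: "star ?b M P = {e\<^sub>1, e\<^sub>2, e\<^sub>3}" "distinct [e\<^sub>1, e\<^sub>2, e\<^sub>3]"
        by (auto simp: card_3_iff)
      have step: ?thesis
        if st3: "star ?b M P = {e\<^sub>1, e\<^sub>2, e\<^sub>3}" "distinct [e\<^sub>1, e\<^sub>2, e\<^sub>3]"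
          and x: "d e\<^sub>1 = {x, a}" "a \<in> P" "x \<in> X" "X \<in> \<P>" "X \<noteq> P"
          and y: "d e\<^sub>2 = {y, b}" "b \<in> P" "y \<in> Y" "Y \<in> \<P>" "Y \<noteq> P"
          and z: "d e\<^sub>3 = {z, c}" "c \<in> P" "z \<in> Z" "Z \<in> \<P>" "Z \<noteq> P"
          and add: "addable 2 ?b ?M ?Q X Y"
        for e\<^sub>1 e\<^sub>2 e\<^sub>3 x y z a b c X Y Z
      proof -
        let ?d = "d(e\<^sub>1 := {x, y})"
        have eM: "e\<^sub>1 \<in> M" "e\<^sub>2 \<in> M" "e\<^sub>3 \<in> M" using st3 sM by auto
        have "d e\<^sub>1 \<inter> d e\<^sub>2 = {}" "d e\<^sub>2 \<inter> d e\<^sub>3 = {}" "d e\<^sub>1 \<inter> d e\<^sub>3 = {}"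
          using match[OF eM(1,2)] match[OF eM(2,3)] match[OF eM(1,3)] st3(2) by auto
        then have ne: "x \<noteq> y" "y \<noteq> z" "x \<noteq> z" "a \<noteq> c" "b \<noteq> c" using x(1) y(1) z(1) by auto
        have XY: "X \<noteq> Y"
        proof
          assume "X = Y"
          then have "{X} \<subseteq> ?Q \<and> X \<in> {X} \<and> Y \<in> {X} \<and> 2 \<le> card {X} + 1" using x by auto
          then have "card (inside ?b ?M {X}) + 2 < 2 * card {X}"
            using add unfolding addable_def by blast
          then show False by simp
        qed
        have e1: "e\<^sub>1 \<notin> ?M" using st3 by simp
        have "tight 2 (?b(e\<^sub>1 := {X, Y})) (insert e\<^sub>1 ?M) ?Q"
          by (rule tight_reduce_deg_3[OF t P st3 _ _ XY add]) (use x y in auto)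
        moreover have "blocks_met ?Q ?d e\<^sub>1 = {X, Y}"
          by (rule blocks_met_edge[OF disQ, of X Y x y]) (use x y in auto)
        ultimately have tQ: "tight 2 (blocks_met ?Q ?d) (insert e\<^sub>1 ?M) ?Q"
        proof (elim tight_cong)
          show "blocks_met ?Q ?d e = (?b(e\<^sub>1 := {X, Y})) e" if "e \<in> insert e\<^sub>1 ?M" for e
          proof (cases "e = e\<^sub>1")
            case True
            then show ?thesis using \<open>blocks_met ?Q ?d e\<^sub>1 = {X, Y}\<close> by simp
          next
            case False
            then have "blocks_met ?Q d e = ?b e" using bQ[of e] that by blast
            then show ?thesis using False unfolding blocks_met_def by simp
          qed
        qed
        have dq: "?d e \<subseteq> \<Union>?Q \<and> card (?d e) = 2" if "e \<in> insert e\<^sub>1 ?M" for e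
        proof (cases "e = e\<^sub>1")
          case True
          then show ?thesis using x(3-5) y(3-5) ne(1) by auto
        next
          case False
          then have "e \<in> ?M" using that by blast
          then show ?thesis using inQ[of e] M[of e] False by auto
        qed
        have out: "?d e \<inter> {x, y} = {}" if "e \<in> ?M" for e
        proof -
          have "e \<in> M" "e \<noteq> e\<^sub>1" "e \<noteq> e\<^sub>2" using that st3 by auto
          then have "d e \<inter> d e\<^sub>1 = {}" "d e \<inter> d e\<^sub>2 = {}"
            using match[OF _ eM(1), of e] match[OF _ eM(2), of e] by blast+
          then show ?thesis using x(1) y(1) \<open>e \<noteq> e\<^sub>1\<close> by auto
        qed
        have matchQ: "?d e \<inter> ?d f = {}" if "e \<in> insert e\<^sub>1 ?M" "f \<in> insert e\<^sub>1 ?M" "e \<noteq> f" for e f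
          using that out[of e] out[of f] match[of e f] by (cases "e = e\<^sub>1"; cases "f = e\<^sub>1") auto
        have thrQ: "threadable ?d (I R) R p q" if "R \<in> ?Q" "p \<in> R" "q \<in> R" "p \<noteq> q" for R p q
        proof -
          have "threadable d (I R) R p q" using thr that by blast
          moreover have "e\<^sub>1 \<notin> I R" using IM[of R] that(1) eM(1) by auto
          ultimately show ?thesis unfolding threadable_def
            by (metis (no_types, lifting) fun_upd_other saturates_cong)
        qed
        have IMQ: "I R \<inter> insert e\<^sub>1 ?M = {}" if "R \<in> ?Q" for R using IM[of R] that eM(1) by auto
        obtain vs s t where vs: "distinct vs" "set vs = \<Union>?Q"
          "saturates ?d vs (insert e\<^sub>1 ?M \<union> \<Union>(I ` ?Q)) (\<Union>?Q \<times> UNIV - {(s, True), (t, False)})"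
        proof (atomize_elim, rule less.hyps[OF less' tQ disQ dq matchQ])
          show "\<exists>p\<in>R. \<exists>q\<in>R. p \<noteq> q" if "R \<in> ?Q" for R using two[of R] that by blast
          show "I R \<inter> I R' = {}" if "R \<in> ?Q" "R' \<in> ?Q" "R \<noteq> R'" for R R' using II[of R R'] that by blast
        qed (fact thrQ IMQ | assumption)+
        have vs3: "saturates ?d vs (insert e\<^sub>1 E) (\<Union>?Q \<times> UNIV - {(s, True), (t, False)})"
          using vs(3) unfolding E_def by simp
        have e1E: "e\<^sub>1 \<notin> E" using starE st3(1) by auto
        have "\<exists>vs'. distinct vs' \<and> set vs' = set vs \<union> P \<and> saturates d vs' (E \<union> I P \<union> {e\<^sub>1, e\<^sub>2, e\<^sub>3})
            ((\<Union>?Q \<times> UNIV - {(s, True), (t, False)}) \<union> P \<times> UNIV)"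
        proof (rule insert_block_deg_3[OF vs(1) vs3, of x y d z e\<^sub>1 a e\<^sub>2 b e\<^sub>3 c])
          show "{x, y, z} \<subseteq> set vs" using vs(2) x y z by auto
          show "threadable d (I P) P a c" "threadable d (I P) P b c"
            using thr[OF P] x(2) y(2) z(2) ne by auto
          show "{e\<^sub>1, e\<^sub>2, e\<^sub>3} \<inter> (E \<union> I P) = {}" using starE st3(1) by simp
        qed (use e1E x(1,2) y(1,2) z(1,2) ne st3(2) vs(2) PQ EI in auto)
        then show ?thesis using finish vs(2) st3(1) by metis
      qed
      obtain x a X where x: "d e\<^sub>1 = {x, a}" "a \<in> P" "x \<in> X" "X \<in> \<P>" "X \<noteq> P" "?b e\<^sub>1 = {P, X}"
        using nb[of e\<^sub>1] st3(1) by auto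
      obtain y b Y where y: "d e\<^sub>2 = {y, b}" "b \<in> P" "y \<in> Y" "Y \<in> \<P>" "Y \<noteq> P" "?b e\<^sub>2 = {P, Y}"
        using nb[of e\<^sub>2] st3(1) by auto
      obtain z c Z where z: "d e\<^sub>3 = {z, c}" "c \<in> P" "z \<in> Z" "Z \<in> \<P>" "Z \<noteq> P" "?b e\<^sub>3 = {P, Z}"
        using nb[of e\<^sub>3] st3(1) by auto
      have "?b e \<subseteq> {P, X, Y, Z}" if "e \<in> star ?b M P" for e
        using that st3(1) x(6) y(6) z(6) by auto
      from addable_pair_2[OF t P c3 this] show ?thesis
      proof
        assume "addable 2 ?b ?M ?Q X Y"
        then show ?thesis by (rule step[OF st3 x(1-5) y(1-5) z(1-5)])
      next
        assume "addable 2 ?b ?M ?Q Y Z"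
        then show ?thesis by (intro step[OF _ _ y(1-5) z(1-5) x(1-5)]) (use st3 in auto)
      qed
    qed
  qed
qed

section \<open>Two edge-disjoint spanning trees\<close>

definition adj :: "('e \<Rightarrow> 'v set) \<Rightarrow> 'e set \<Rightarrow> 'v rel" where
  "adj d S = {(x, y). \<exists>e\<in>S. d e = {x, y}}"

definition forest :: "('e \<Rightarrow> 'v set) \<Rightarrow> 'e set \<Rightarrow> bool" where
  "forest d S \<longleftrightarrow> (\<forall>e\<in>S. \<forall>u v. d e = {u, v} \<longrightarrow> (u, v) \<notin> (adj d (S - {e}))\<^sup>*)"

definition simple_path :: "('e \<Rightarrow> 'v set) \<Rightarrow> 'e set \<Rightarrow> 'v list \<Rightarrow> 'e list \<Rightarrow> bool" where
  "simple_path d S vs es \<longleftrightarrow> distinct vs \<and> length vs = Suc (length es) \<and> set es \<subseteq> S \<and>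
     (\<forall>i < length es. d (es ! i) = {vs ! i, vs ! Suc i})"

lemma rtrancl_simple_path:
  assumes "(u, v) \<in> (adj d S)\<^sup>*"
  shows "\<exists>vs es. simple_path d S vs es \<and> hd vs = u \<and> last vs = v"
  using assms
proof (induction rule: converse_rtrancl_induct)
  case base
  then show ?case by (intro exI[of _ "[v]"] exI[of _ "[]"]) (simp add: simple_path_def)
next
  case (step u w)
  then obtain vs es where p: "simple_path d S vs es" "hd vs = w" "last vs = v" by blast
  then have ne: "vs \<noteq> []" unfolding simple_path_def by auto
  obtain e where e: "e \<in> S" "d e = {u, w}" using step(1) unfolding adj_def by blast
  show ?case
  proof (cases "u \<in> set vs")
    case True
    then obtain i where i: "i < length vs" "vs ! i = u" by (meson in_set_conv_nth)
    then have "simple_path d S (drop i vs) (drop i es)"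
      using p(1) set_drop_subset[of i es] unfolding simple_path_def by auto
    moreover have "hd (drop i vs) = u" using i by (simp add: hd_drop_conv_nth)
    moreover have "last (drop i vs) = v" using i p(3) by (simp add: last_drop)
    ultimately show ?thesis by blast
  next
    case False
    have "simple_path d S (u # vs) (e # es)"
      using p e ne False unfolding simple_path_def
      by (auto simp: nth_Cons hd_conv_nth split: nat.split)
    then show ?thesis using p(3) ne by (intro exI[of _ "u # vs"] exI[of _ "e # es"]) auto
  qed
qed

lemma simple_path_distinct_edges:
  assumes "simple_path d S vs es"
  shows "distinct es"
proof -
  have "i = j" if "i < length es" "j < length es" "es ! i = es ! j" for i j
  proof -
    have "{vs ! i, vs ! Suc i} = {vs ! j, vs ! Suc j}" using assms that unfolding simple_path_def by metis
    then show ?thesis using assms that unfolding simple_path_def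
      by (auto simp: doubleton_eq_iff nth_eq_iff_index_eq)
  qed
  then show ?thesis unfolding distinct_conv_nth by blast
qed

text \<open>
  A walk between the ends of \<open>e\<close> that avoids \<open>e\<close> contains a simple path, and \<open>e\<close> closes it to a cycle.
\<close>

lemma mg_tree_forest:
  assumes "mg_tree T"
  shows "forest (mends T) (medges T)"
  unfolding forest_def
proof (intro ballI allI impI notI)
  let ?d = "mends T"
  fix e u v
  assume e: "e \<in> medges T" "?d e = {u, v}" and uv: "(u, v) \<in> (adj ?d (medges T - {e}))\<^sup>*"
  have m: "multigraph T" using assms unfolding mg_tree_def by simp
  have "u \<noteq> v" using m e unfolding multigraph_def by fastforce
  obtain vs es where p: "simple_path ?d (medges T - {e}) vs es" "hd vs = u" "last vs = v"
    using rtrancl_simple_path[OF uv] by blast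
  note p' = p(1)[unfolded simple_path_def]
  have es: "es \<noteq> []" using p p' \<open>u \<noteq> v\<close> by (cases vs) auto
  have ends: "?d ((es @ [e]) ! i) = {vs ! i, vs ! (Suc i mod length vs)}" if "i < length (es @ [e])" for i
  proof (cases "i < length es")
    case True
    then show ?thesis using p' by (simp add: nth_append)
  next
    case False
    then have i: "i = length es" using that by simp
    have "vs \<noteq> []" using p' by auto
    then have "vs ! i = v" "vs ! 0 = u" using p p' i by (auto simp: last_conv_nth hd_conv_nth)
    moreover have "Suc i mod length vs = 0" using p' i by simp
    ultimately show ?thesis using e(2) i by (simp add: insert_commute)
  qed
  have "set vs \<subseteq> mverts T"
  proof
    fix w assume "w \<in> set vs"
    then obtain i where i: "i < length vs" "vs ! i = w" by (meson in_set_conv_nth)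
    then have "i < length (es @ [e])" using p' by simp
    moreover have "(es @ [e]) ! i \<in> medges T"
      using p' e(1) calculation nth_mem[of i "es @ [e]"] by auto
    ultimately show "w \<in> mverts T" using ends[of i] i m unfolding multigraph_def by auto
  qed
  then have "mg_cycle T vs (es @ [e])"
    using ends p' es e simple_path_distinct_edges[OF p(1)] unfolding mg_cycle_def
    by (cases es) auto
  then show False using assms unfolding mg_tree_def by blast
qed

lemma forest_subset:
  assumes "forest d S" "S' \<subseteq> S"
  shows "forest d S'"
proof -
  have "adj d (S' - {e}) \<subseteq> adj d (S - {e})" for e using assms(2) unfolding adj_def by blast
  then have "(adj d (S' - {e}))\<^sup>* \<subseteq> (adj d (S - {e}))\<^sup>*" for e by (rule rtrancl_mono)
  then show ?thesis using assms unfolding forest_def by blast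
qed

text \<open>
  The function \<open>f\<close> names the connected components, so that \<open>card (f ` V)\<close> is their number. Each edge
  merges at most two components, and exactly two if the edges form a forest. Carrying a labelling
  through the induction makes merging a plain renaming of one label.
\<close>

lemma component_labelling:
  assumes "finite S" "finite V" "\<And>e. e \<in> S \<Longrightarrow> d e \<subseteq> V \<and> card (d e) = 2"
  shows "\<exists>f :: 'v \<Rightarrow> 'v. (\<forall>u\<in>V. \<forall>v\<in>V. f u = f v \<longleftrightarrow> (u, v) \<in> (adj d S)\<^sup>*) \<and>
    card V \<le> card (f ` V) + card S \<and> (forest d S \<longrightarrow> card V = card (f ` V) + card S)"
  using assms
proof (induction S rule: finite_induct)
  case empty
  have "adj d {} = {}" unfolding adj_def by auto
  then show ?case by (intro exI[of _ "\<lambda>x. x"]) auto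
next
  case (insert e S)
  then obtain f :: "'v \<Rightarrow> 'v" where f: "\<forall>u\<in>V. \<forall>v\<in>V. f u = f v \<longleftrightarrow> (u, v) \<in> (adj d S)\<^sup>*"
    and c: "card V \<le> card (f ` V) + card S" "forest d S \<longrightarrow> card V = card (f ` V) + card S"
    by auto
  obtain a b where ab: "d e = {a, b}" "a \<in> V" "b \<in> V"
    using insert.prems(2)[of e] by (auto simp: card_2_iff)
  define g where "g w = (if f w = f b then f a else f w)" for w
  have sub: "adj d S \<subseteq> adj d (insert e S)" unfolding adj_def by blast
  note old = rtrancl_mono[OF sub]
  have new: "(a, b) \<in> adj d (insert e S)" "(b, a) \<in> adj d (insert e S)"
    using ab unfolding adj_def by auto
  have step: "x \<in> V \<and> y \<in> V \<and> g x = g y" if xy: "(x, y) \<in> adj d (insert e S)" for x y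
  proof -
    obtain e' where e': "e' \<in> insert e S" "d e' = {x, y}" using xy unfolding adj_def by blast
    have V: "x \<in> V" "y \<in> V" using insert.prems(2)[OF e'(1)] e'(2) by auto
    show ?thesis
    proof (cases "e' = e")
      case True
      then have "(x = a \<and> y = b) \<or> (x = b \<and> y = a)" using ab e' by (auto simp: doubleton_eq_iff)
      then show ?thesis using V unfolding g_def by auto
    next
      case False
      then have "(x, y) \<in> adj d S" using e' unfolding adj_def by auto
      then have "f x = f y" using f V by blast
      then show ?thesis using V unfolding g_def by auto
    qed
  qed
  have 1: "g u = g v" if "(u, v) \<in> (adj d (insert e S))\<^sup>*" for u v
    using that by (induction rule: rtrancl_induct) (use step in auto)
  have conn: "(u, v) \<in> (adj d (insert e S))\<^sup>*" if "u \<in> V" "v \<in> V" "f u = f v" for u v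
    using f that old by blast
  have 2: "(u, v) \<in> (adj d (insert e S))\<^sup>*" if uv: "u \<in> V" "v \<in> V" "g u = g v" for u v
  proof -
    consider "f u = f v" | "f u = f b" "f v = f a" | "f u = f a" "f v = f b"
      using uv(3) unfolding g_def by (auto split: if_splits)
    then show ?thesis
    proof cases
      case 1
      then show ?thesis using conn uv by blast
    next
      case 2
      then have "(u, b) \<in> (adj d (insert e S))\<^sup>*" "(a, v) \<in> (adj d (insert e S))\<^sup>*"
        using conn uv ab by auto
      then show ?thesis using new(2) by (meson converse_rtrancl_into_rtrancl rtrancl_trans)
    next
      case 3
      then have "(u, a) \<in> (adj d (insert e S))\<^sup>*" "(b, v) \<in> (adj d (insert e S))\<^sup>*"
        using conn uv ab by auto
      then show ?thesis using new(1) by (meson converse_rtrancl_into_rtrancl rtrancl_trans)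
    qed
  qed
  have cS: "card (insert e S) = Suc (card S)" using insert by simp
  have fin: "finite (f ` V)" using insert.prems(1) by simp
  have img: "g ` V = (if f a = f b then f ` V else f ` V - {f b})"
    using ab unfolding g_def by (auto simp: image_iff)
  have pos: "f b \<in> f ` V" using ab by blast
  have "card V \<le> card (g ` V) + card (insert e S)"
    using c(1) cS img fin pos by (auto simp: card_Diff_singleton)
  moreover have "card V = card (g ` V) + card (insert e S)" if F: "forest d (insert e S)"
  proof -
    have "forest d S" using forest_subset[OF F] by blast
    moreover have "insert e S - {e} = S" using insert by auto
    then have "(a, b) \<notin> (adj d S)\<^sup>*" using F ab unfolding forest_def by auto
    then have "f a \<noteq> f b" using f ab by blast
    moreover have "card (f ` V) > 0" using fin pos by (auto simp: card_gt_0_iff)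
    ultimately show ?thesis using c(2) cS img fin pos by (auto simp: card_Diff_singleton)
  qed
  ultimately show ?case using 1 2 by (intro exI[of _ g]) blast
qed

lemma forest_card:
  fixes d :: "'e \<Rightarrow> 'v set"
  assumes "finite S" "finite V" "V \<noteq> {}" "\<And>e. e \<in> S \<Longrightarrow> d e \<subseteq> V \<and> card (d e) = 2" "forest d S"
  shows "card S + 1 \<le> card V"
proof -
  obtain f :: "'v \<Rightarrow> 'v" where "card V = card (f ` V) + card S"
    using component_labelling[of S V d] assms by metis
  moreover have "card (f ` V) > 0" using assms by (auto simp: card_gt_0_iff)
  ultimately show ?thesis by linarith
qed

lemma connected_card:
  fixes d :: "'e \<Rightarrow> 'v set"
  assumes "finite S" "finite V" "\<And>e. e \<in> S \<Longrightarrow> d e \<subseteq> V \<and> card (d e) = 2"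
    "\<And>u v. u \<in> V \<Longrightarrow> v \<in> V \<Longrightarrow> (u, v) \<in> (adj d S)\<^sup>*"
  shows "card V \<le> card S + 1"
proof -
  obtain f :: "'v \<Rightarrow> 'v" where f: "card V \<le> card (f ` V) + card S"
    "\<forall>u\<in>V. \<forall>v\<in>V. f u = f v \<longleftrightarrow> (u, v) \<in> (adj d S)\<^sup>*"
    using component_labelling[of S V d] assms by metis
  have const: "f u = f v" if "u \<in> V" "v \<in> V" for u v
    using f(2)[rule_format, OF that] assms(4)[OF that] by (rule iffD2)
  have "card (f ` V) \<le> 1"
  proof (cases "V = {}")
    case False
    then obtain v where v: "v \<in> V" by blast
    have "f ` V \<subseteq> {f v}"
    proof (rule image_subsetI)
      show "f u \<in> {f v}" if "u \<in> V" for u unfolding const[OF that v] by simp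
    qed
    then have "card (f ` V) \<le> card {f v}" by (intro card_mono) simp_all
    then show ?thesis by simp
  qed simp
  then show ?thesis using f(1) by linarith
qed

theorem two_T_graph_tight:
  assumes "two_T_graph G"
  shows "tight 2 (mends G) (medges G) (mverts G)"
proof -
  let ?d = "mends G"
  obtain T U where T: "mg_spanning_tree T G" and U: "mg_spanning_tree U G"
    and TU: "medges T \<inter> medges U = {}" "medges G = medges T \<union> medges U"
    using assms unfolding two_T_graph_def by blast
  have G: "multigraph G" using assms unfolding two_T_graph_def by simp
  note G' = G[unfolded multigraph_def]
  have sub: "mends H = ?d" "mverts H = mverts G" "mg_tree H" "finite (medges H)"
    "\<And>e. e \<in> medges H \<Longrightarrow> ?d e \<subseteq> mverts G \<and> card (?d e) = 2"
    if "mg_spanning_tree H G" for H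
    using that unfolding mg_spanning_tree_def mg_subgraph_def multigraph_def by auto
  have bound: "card (inside ?d (medges H) X) + 1 \<le> card X"
    if H: "mg_spanning_tree H G" and X: "X \<subseteq> mverts G" "X \<noteq> {}" for H X
  proof (rule forest_card)
    show "finite (inside ?d (medges H) X)" using sub(4)[OF H] by (rule inside_finite)
    show "finite X" using X G' finite_subset by blast
    show "?d e \<subseteq> X \<and> card (?d e) = 2" if "e \<in> inside ?d (medges H) X" for e
      using that sub(5)[OF H] unfolding inside_def by auto
    have "forest ?d (medges H)" using mg_tree_forest[OF sub(3)[OF H]] sub(1)[OF H] by simp
    then show "forest ?d (inside ?d (medges H) X)"
      by (rule forest_subset) (auto simp: inside_def)
  qed fact
  have low: "card (mverts G) \<le> card (medges H) + 1" and ne: "mverts G \<noteq> {}"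
    if H: "mg_spanning_tree H G" for H
  proof -
    have c: "mg_connected H" using sub(3)[OF H] unfolding mg_tree_def by simp
    show "mverts G \<noteq> {}" using c sub(2)[OF H] unfolding mg_connected_def by simp
    have "(u, v) \<in> (adj ?d (medges H))\<^sup>*" if "u \<in> mverts G" "v \<in> mverts G" for u v
      using c that sub(1,2)[OF H] unfolding mg_connected_def adj_def by simp
    then show "card (mverts G) \<le> card (medges H) + 1"
      using G' sub(4,5)[OF H] by (intro connected_card[of _ _ ?d]) auto
  qed
  have two: "card (inside ?d (medges G) X) + 2 \<le> 2 * card X" if X: "X \<subseteq> mverts G" "X \<noteq> {}" for X
  proof -
    have "inside ?d (medges G) X = inside ?d (medges T) X \<union> inside ?d (medges U) X"
      using TU unfolding inside_def by auto
    then have "card (inside ?d (medges G) X) \<le> card (inside ?d (medges T) X) + card (inside ?d (medges U) X)"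
      by (simp add: card_Un_le)
    then show ?thesis using bound[OF T X] bound[OF U X] by linarith
  qed
  have "card (medges G) + 2 = 2 * card (mverts G)"
  proof -
    have "inside ?d (medges G) (mverts G) = medges G" using G' unfolding inside_def by auto
    then have "card (medges G) + 2 \<le> 2 * card (mverts G)" using two[of "mverts G"] ne[OF T] by simp
    moreover have "card (medges G) = card (medges T) + card (medges U)"
      using TU sub(4)[OF T] sub(4)[OF U] by (simp add: card_Un_disjoint)
    ultimately show ?thesis using low[OF T] low[OF U] by linarith
  qed
  moreover have "sparse 2 ?d (medges G) (mverts G)"
    unfolding sparse_def
  proof (intro allI impI)
    fix X assume X: "X \<subseteq> mverts G" "2 \<le> card X + 1"
    then have "X \<noteq> {}" by auto
    then show "card (inside ?d (medges G) X) + 2 \<le> 2 * card X" by (rule two[OF X(1)])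
  qed
  ultimately show ?thesis unfolding tight_def using G' by auto
qed

section \<open>The partition into generic circuits\<close>

lemma medges_mg_induce: "medges (mg_induce G X) = inside (mends G) (medges G) X"
  unfolding mg_induce_def inside_def by simp

lemma circuit_of_cases:
  assumes "circuit_of H G"
  shows "H = mg_induce G (mverts H)" "mverts H \<subseteq> mverts G" "generic_circuit (mg_induce G (mverts H))"
  using assms unfolding circuit_of_def mg_induce_def by auto

lemma generic_circuit_counts:
  assumes "generic_circuit (mg_induce G X)"
  shows "finite X" "2 \<le> card X" "card (inside (mends G) (medges G) X) + 2 = 2 * card X"
    "\<And>Y. Y \<subset> X \<Longrightarrow> 2 \<le> card Y \<Longrightarrow> card (inside (mends G) (medges G) Y) + 3 \<le> 2 * card Y"
proof -
  have m: "mverts (mg_induce G X) = X" unfolding mg_induce_def by simp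
  note g = assms[unfolded generic_circuit_def m medges_mg_induce]
  have "finite (mverts (mg_induce G X))" using g unfolding multigraph_def by (elim conjE)
  then show fin: "finite X" unfolding m .
  have pos: "2 * card X - 2 > 0" using g by (elim conjE)
  then show "2 \<le> card X" by linarith
  have "card (inside (mends G) (medges G) X) = 2 * card X - 2" using g by (elim conjE)
  then show "card (inside (mends G) (medges G) X) + 2 = 2 * card X" using pos by linarith
  fix Y assume Y: "Y \<subset> X" "2 \<le> card Y"
  have "card Y \<le> card X - 1" using psubset_card_mono[OF fin Y(1)] by linarith
  then have "card (inside (mends (mg_induce G X)) (inside (mends G) (medges G) X) Y) \<le> 2 * card Y - 3"
    using g Y by blast
  moreover have "inside (mends (mg_induce G X)) (inside (mends G) (medges G) X) Y = inside (mends G) (medges G) Y"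
    using Y(1) unfolding inside_def mg_induce_def by auto
  ultimately show "card (inside (mends G) (medges G) Y) + 3 \<le> 2 * card Y" using Y(2) by simp
qed

lemma circuits_nested:
  assumes "circuit_of H G" "circuit_of K G" "mverts H \<subseteq> mverts K"
  shows "mverts H = mverts K"
proof (rule ccontr)
  assume "mverts H \<noteq> mverts K"
  then have "mverts H \<subset> mverts K" using assms(3) by blast
  then show False
    using generic_circuit_counts(2,3)[OF circuit_of_cases(3)[OF assms(1)]]
      generic_circuit_counts(4)[OF circuit_of_cases(3)[OF assms(2)], of "mverts H"] by auto
qed

text \<open>
  The circuits within the hypergraph component of a common vertex form a maximal connected set. Its
  union is a generic component and thus itself a circuit, and a circuit properly contains no other.
\<close>

lemma circuits_disjoint:
  assumes comp: "\<forall>H. generic_component G H \<longrightarrow> circuit_of H G"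
    and H: "circuit_of H G" and K: "circuit_of K G" and v: "v \<in> mverts H" "v \<in> mverts K"
  shows "mverts H = mverts K"
proof -
  let ?V = "mverts G" and ?H = "mverts ` {L. circuit_of L G}"
  let ?r = "{(x, y). \<exists>X\<in>?H. x \<in> X \<and> y \<in> X}"
  let ?R = "Restr (?r\<^sup>*) ?V"
  have "sym ?r" unfolding sym_def by blast
  then have "sym (?r\<^sup>*)" by (rule sym_rtrancl)
  then have equiv: "equiv ?V ?R"
    by (auto simp: equiv_def refl_on_def sym_def trans_def)
  have vV: "v \<in> ?V" using circuit_of_cases(2)[OF H] v(1) by blast
  define C where "C = ?R `` {v}"
  have C: "C \<in> hypergraph_components ?V ?H"
    unfolding hypergraph_components_def C_def using vV by (rule quotientI)
  have meets: "mverts L \<subseteq> C" if L: "circuit_of L G" "v \<in> mverts L" for L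
  proof
    fix x assume x: "x \<in> mverts L"
    then have "(v, x) \<in> ?r" using L by blast
    then show "x \<in> C" unfolding C_def using vV x circuit_of_cases(2)[OF L(1)] by blast
  qed
  let ?C = "{L. circuit_of L G \<and> mverts L \<subseteq> C}"
  have "connected_circuit_set G ?C"
    unfolding connected_circuit_set_def circuits_connected_def using H meets[OF H v(1)] C by blast
  moreover have "\<D> = ?C" if D: "connected_circuit_set G \<D>" "?C \<subseteq> \<D>" for \<D>
  proof
    show "\<D> \<subseteq> ?C"
    proof
      fix L assume L: "L \<in> \<D>"
      have "H \<in> \<D>" using D(2) H meets[OF H v(1)] by blast
      then obtain C' where C': "C' \<in> hypergraph_components ?V ?H" "mverts H \<subseteq> C'" "mverts L \<subseteq> C'"
        using D(1) L unfolding connected_circuit_set_def circuits_connected_def by blast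
      have "v \<in> C" "v \<in> C'" using meets[OF H v(1)] C'(2) v(1) by auto
      then have "C' = C"
        using quotient_disj[OF equiv] C C'(1) unfolding hypergraph_components_def by blast
      moreover have "circuit_of L G" using D(1) L unfolding connected_circuit_set_def by blast
      ultimately show "L \<in> ?C" using C'(3) by blast
    qed
  qed (use D in blast)
  ultimately have "nontrivial_generic_component G
      \<lparr>mverts = \<Union> (mverts ` ?C), medges = \<Union> (medges ` ?C), mends = mends G\<rparr>"
    (is "nontrivial_generic_component G ?M") unfolding nontrivial_generic_component_def by blast
  then have M: "circuit_of ?M G" using comp unfolding generic_component_def by blast
  have "mverts H \<subseteq> mverts ?M" "mverts K \<subseteq> mverts ?M" using H K meets v by auto
  then show ?thesis using circuits_nested[OF H M] circuits_nested[OF K M] by simp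
qed

text \<open>
  A vertex outside all circuits would be a trivial generic component, which has too few vertices to be
  a circuit.
\<close>

lemma circuits_cover:
  assumes comp: "\<forall>H. generic_component G H \<longrightarrow> circuit_of H G" and v: "v \<in> mverts G"
  shows "\<exists>H. circuit_of H G \<and> v \<in> mverts H"
proof (rule ccontr)
  assume "\<not> ?thesis"
  then have "trivial_generic_component G \<lparr>mverts = {v}, medges = {}, mends = mends G\<rparr>"
    using v unfolding trivial_generic_component_def by blast
  then have "circuit_of \<lparr>mverts = {v}, medges = {}, mends = mends G\<rparr> G"
    using comp unfolding generic_component_def by blast
  from generic_circuit_counts(2)[OF circuit_of_cases(3)[OF this]] show False by simp
qed

text \<open>
  A union of blocks has as many edges inside its blocks as their sizes permit, so what a set of
  blocks may have in addition is precisely the bound for the quotient.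
\<close>

theorem quotient_tight:
  assumes t: "tight 2 d E V" and dis: "disjoint \<P>" and cover: "\<Union>\<P> = V"
    and blocks: "\<And>P. P \<in> \<P> \<Longrightarrow> P \<noteq> {} \<and> card (inside d E P) + 2 = 2 * card P"
  shows "tight 2 (blocks_met \<P> d) {e \<in> E. \<forall>P\<in>\<P>. \<not> d e \<subseteq> P} \<P>"
proof -
  note t' = tightD[OF t]
  let ?b = "blocks_met \<P> d" and ?M = "{e \<in> E. \<forall>P\<in>\<P>. \<not> d e \<subseteq> P}"
  have finP: "finite \<P>" using t'(1) unfolding cover[symmetric] by (rule finite_UnionD)
  have finb: "finite P" if "P \<in> \<P>" for P
  proof (rule finite_subset)
    show "P \<subseteq> V" using that cover by blast
  qed (rule t'(1))
  have uniq: "P = Q" if "P \<in> \<P>" "Q \<in> \<P>" "x \<in> P" "x \<in> Q" for P Q x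
    using disjointD[OF dis that(1,2)] that(3,4) by blast
  have two: "card (?b e) = 2" if e: "e \<in> ?M" for e
  proof -
    obtain x y where xy: "d e = {x, y}" using t'(4)[of e] e by (auto simp: card_2_iff)
    obtain P Q where PQ: "P \<in> \<P>" "Q \<in> \<P>" "x \<in> P" "y \<in> Q" using t'(3)[of e] e xy cover by auto
    then have "?b e = {P, Q}" using xy dis by (intro blocks_met_edge) auto
    moreover have "P \<noteq> Q" using e PQ xy by auto
    ultimately show ?thesis by simp
  qed
  have split: "card (inside d E (\<Union>\<Q>)) + 2 * card \<Q> = 2 * card (\<Union>\<Q>) + card (inside ?b ?M \<Q>)"
    if Q: "\<Q> \<subseteq> \<P>" for \<Q>
  proof -
    have finQ: "finite \<Q>" using Q finP finite_subset by blast
    have mem: "P \<in> \<Q>" if "P \<in> \<P>" "x \<in> P" "x \<in> \<Union>\<Q>" for P x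
      using that Q uniq by (metis UnionE subsetD)
    have "inside d E (\<Union>\<Q>) = (\<Union>P\<in>\<Q>. inside d E P) \<union> inside ?b ?M \<Q>"
    proof (rule set_eqI)
      fix e
      show "e \<in> inside d E (\<Union>\<Q>) \<longleftrightarrow> e \<in> (\<Union>P\<in>\<Q>. inside d E P) \<union> inside ?b ?M \<Q>"
      proof (cases "e \<in> E")
        case True
        obtain x y where xy: "d e = {x, y}" using t'(4)[OF True] by (auto simp: card_2_iff)
        obtain X Y where XY: "X \<in> \<P>" "Y \<in> \<P>" "x \<in> X" "y \<in> Y" using t'(3)[OF True] xy cover by blast
        have b: "?b e = {X, Y}" using xy XY dis by (intro blocks_met_edge) auto
        have sub: "d e \<subseteq> P \<longleftrightarrow> X = P \<and> Y = P" if "P \<in> \<P>" for P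
          unfolding xy using XY(3,4) uniq[OF XY(1) that XY(3)] uniq[OF XY(2) that XY(4)] by blast
        have "d e \<subseteq> \<Union>\<Q> \<longleftrightarrow> X \<in> \<Q> \<and> Y \<in> \<Q>" using xy XY mem[of X x] mem[of Y y] by auto
        moreover have "(\<exists>P\<in>\<Q>. d e \<subseteq> P) \<longleftrightarrow> (\<exists>P\<in>\<Q>. X = P \<and> Y = P)"
          by (rule bex_cong[OF refl]) (rule sub[OF subsetD[OF Q]])
        then have "(\<exists>P\<in>\<Q>. d e \<subseteq> P) \<longleftrightarrow> X = Y \<and> X \<in> \<Q>" by auto
        moreover have "(\<forall>P\<in>\<P>. \<not> d e \<subseteq> P) \<longleftrightarrow> (\<forall>P\<in>\<P>. \<not> (X = P \<and> Y = P))"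
          by (rule ball_cong[OF refl]) (simp only: sub)
        then have "(\<forall>P\<in>\<P>. \<not> d e \<subseteq> P) \<longleftrightarrow> X \<noteq> Y" using XY(1,2) by auto
        ultimately show ?thesis using True b unfolding inside_def by simp blast
      qed (auto simp: inside_def)
    qed
    moreover have "(\<Union>P\<in>\<Q>. inside d E P) \<inter> inside ?b ?M \<Q> = {}"
      using Q unfolding inside_def by blast
    moreover have "finite (\<Union>P\<in>\<Q>. inside d E P)" "finite (inside ?b ?M \<Q>)"
      using finQ t'(2) by (auto simp: inside_def)
    ultimately have "card (inside d E (\<Union>\<Q>)) = card (\<Union>P\<in>\<Q>. inside d E P) + card (inside ?b ?M \<Q>)"
      by (simp add: card_Un_disjoint)
    moreover have "card (\<Union>P\<in>\<Q>. inside d E P) = (\<Sum>P\<in>\<Q>. card (inside d E P))"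
    proof (rule card_UN_disjoint[OF finQ])
      show "\<forall>P\<in>\<Q>. finite (inside d E P)" using t'(2) by (simp add: inside_finite)
      show "\<forall>P\<in>\<Q>. \<forall>R\<in>\<Q>. P \<noteq> R \<longrightarrow> inside d E P \<inter> inside d E R = {}"
      proof (intro ballI impI equals0I)
        fix P R e assume PR: "P \<in> \<Q>" "R \<in> \<Q>" "P \<noteq> R" and e: "e \<in> inside d E P \<inter> inside d E R"
        then obtain x where "x \<in> d e" using t'(4)[of e] unfolding inside_def by fastforce
        then show False using e PR uniq[of P R x] Q unfolding inside_def by blast
      qed
    qed
    moreover have "(\<Sum>P\<in>\<Q>. card (inside d E P)) + 2 * card \<Q> = (\<Sum>P\<in>\<Q>. card (inside d E P) + 2)"
      by (subst sum.distrib) simp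
    moreover have "\<dots> = (\<Sum>P\<in>\<Q>. 2 * card P)" using blocks Q by (intro sum.cong) auto
    moreover have "\<dots> = 2 * card (\<Union>\<Q>)"
    proof -
      have "card (\<Union>\<Q>) = (\<Sum>P\<in>\<Q>. card P)"
        using dis Q finb by (intro card_Union_disjoint) (auto simp: pairwise_def)
      then show ?thesis by (simp add: sum_distrib_left)
    qed
    ultimately show ?thesis by linarith
  qed
  have "sparse 2 ?b ?M \<P>"
    unfolding sparse_def
  proof (intro allI impI)
    fix \<Q> assume Q: "\<Q> \<subseteq> \<P>" "2 \<le> card \<Q> + 1"
    then obtain P where "P \<in> \<Q>" by fastforce
    then have "\<Union>\<Q> \<noteq> {}" using blocks Q(1) by blast
    moreover have sub: "\<Union>\<Q> \<subseteq> V" using Q(1) cover by blast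
    ultimately have "card (\<Union>\<Q>) > 0" using t'(1) finite_subset by (metis card_gt_0_iff)
    then have "card (inside d E (\<Union>\<Q>)) + 2 \<le> 2 * card (\<Union>\<Q>)" by (intro sparseD[OF t'(5) sub]) simp
    then show "card (inside ?b ?M \<Q>) + 2 \<le> 2 * card \<Q>" using split[OF Q(1)] by linarith
  qed
  moreover have "card ?M + 2 = 2 * card \<P>"
  proof -
    have "inside d E (\<Union>\<P>) = E" using t'(3) cover unfolding inside_def by auto
    moreover have "inside ?b ?M \<P> = ?M" unfolding inside_def blocks_met_def by auto
    ultimately show ?thesis using split[of \<P>] t'(6) cover by simp
  qed
  ultimately show ?thesis unfolding tight_def using finP t'(2) two by (auto simp: blocks_met_def)
qed

section \<open>From saturating orders to branchings\<close>

text \<open>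
  Each vertex other than the root \<open>r\<close> has a unique parent edge in \<open>B\<close>, which comes from an \<open>R\<close>-smaller
  vertex. Following parents down reaches \<open>r\<close>, so the graph is connected. An \<open>R\<close>-maximal vertex of a
  cycle would be the child end of both its cycle edges.
\<close>

lemma parent_choice_tree:
  assumes fin: "finite V" "finite B" and r: "r \<in> V"
    and R: "R \<subseteq> V \<times> V" "trans R" "irrefl R"
    and B: "\<And>e. e \<in> B \<Longrightarrow> d e = {p e, c e} \<and> (p e, c e) \<in> R"
    and c: "inj_on c B" "c ` B = V - {r}"
  shows "mg_tree \<lparr>mverts = V, medges = B, mends = d\<rparr>"
proof -
  let ?T = "\<lparr>mverts = V, medges = B, mends = d\<rparr>"
  have finR: "finite R" using finite_subset[OF R(1)] fin by simp
  have ac: "acyclic R" using R(2,3) by (simp add: acyclic_irrefl trancl_id)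
  have irr: "(x, x) \<notin> R" for x using R(3) by (simp add: irrefl_def)
  have m: "multigraph ?T"
  proof -
    have "d e \<subseteq> V \<and> card (d e) = 2" if "e \<in> B" for e
    proof -
      have "(p e, c e) \<in> R" "d e = {p e, c e}" using B[OF that] by auto
      moreover have "p e \<noteq> c e" using irr[of "c e"] calculation(1) by auto
      ultimately show ?thesis using R(1) by auto
    qed
    then show ?thesis unfolding multigraph_def using fin by simp
  qed
  have up: "(r, v) \<in> (adj d B)\<^sup>*" if "v \<in> V" for v
    using finite_acyclic_wf[OF finR ac] that
  proof (induction v rule: wf_induct_rule)
    case (less v)
    show ?case
    proof (cases "v = r")
      case False
      then have "v \<in> c ` B" unfolding c(2) using less.prems by simp
      then obtain e where e: "e \<in> B" "v = c e" by (rule imageE)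
      then have pv: "(p e, v) \<in> R" "d e = {p e, v}" using B[OF e(1)] by simp_all
      then have "p e \<in> V" using R(1) by blast
      then have "(r, p e) \<in> (adj d B)\<^sup>*" using less.IH[OF pv(1)] by simp
      moreover have "(p e, v) \<in> adj d B" using pv(2) e(1) unfolding adj_def by blast
      ultimately show ?thesis by (rule rtrancl_into_rtrancl)
    qed simp
  qed
  have "sym (adj d B)" unfolding sym_def adj_def by (auto simp: insert_commute)
  then have "sym ((adj d B)\<^sup>*)" by (rule sym_rtrancl)
  then have "(u, v) \<in> (adj d B)\<^sup>*" if "u \<in> V" "v \<in> V" for u v
    using up[OF that(1)] up[OF that(2)] by (meson rtrancl_trans symD)
  then have conn: "mg_connected ?T" unfolding mg_connected_def adj_def using r by auto
  have "False" if cyc: "mg_cycle ?T vs es" for vs es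
  proof -
    note cy = cyc[unfolded mg_cycle_def, simplified]
    let ?n = "length es"
    have "set vs \<noteq> {}" using cy by auto
    then obtain m where m: "m \<in> set vs" "\<And>w. (m, w) \<in> R \<Longrightarrow> w \<notin> set vs"
      using wfE_min'[OF finite_acyclic_wf_converse[OF finR ac], of "set vs"] by auto
    then obtain i where i: "i < ?n" "vs ! i = m" using cy by (metis in_set_conv_nth)
    have into: "c (es ! k) = m" if "k < ?n" "d (es ! k) = {m, w}" "w \<in> set vs" for k w
    proof -
      have "es ! k \<in> B" using cy that(1) nth_mem by blast
      then have "{p (es ! k), c (es ! k)} = {m, w}" "(p (es ! k), c (es ! k)) \<in> R" using B that(2) by auto
      then show ?thesis using m(2)[of w] that(3) by (auto simp: doubleton_eq_iff)
    qed
    \<comment> \<open>The cyclic predecessor of \<open>i\<close>.\<close>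
    define j where "j = (i + ?n - 1) mod ?n"
    have j: "j < ?n" "Suc j mod ?n = i" "j \<noteq> i"
    proof -
      have n: "0 < ?n" using i(1) by linarith
      show "j < ?n" unfolding j_def by (rule mod_less_divisor[OF n])
      have "Suc j mod ?n = Suc (i + ?n - 1) mod ?n" unfolding j_def by (rule mod_Suc_eq)
      also have "Suc (i + ?n - 1) = i + ?n" using n by simp
      finally show "Suc j mod ?n = i" using i(1) by simp
      show "j \<noteq> i"
      proof (cases i)
        case 0
        then show ?thesis using i cy unfolding j_def by auto
      next
        case (Suc k)
        then have "j = k" using i unfolding j_def by simp
        then show ?thesis using Suc by simp
      qed
    qed
    have len: "length vs = ?n" using cy by simp
    have ends: "d (es ! k) = {vs ! k, vs ! (Suc k mod ?n)}" if "k < ?n" for k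
      using cy that by simp
    have mem: "vs ! (k mod ?n) \<in> set vs" for k
      using i(1) len by (intro nth_mem) (metis mod_less_divisor not_less_zero gr0I)
    have "c (es ! i) = m"
      by (rule into[OF i(1) _ mem[of "Suc i"]]) (simp add: ends[OF i(1)] i(2))
    moreover have "c (es ! j) = m"
      by (rule into[OF j(1) _ mem[of j]]) (simp add: ends[OF j(1)] i(2) j(1,2) insert_commute)
    moreover have "es ! i \<in> B" "es ! j \<in> B" using i(1) j(1) cy nth_mem by blast+
    ultimately have "es ! i = es ! j" using c(1) by (metis inj_onD)
    then show False using i j cy by (simp add: nth_eq_iff_index_eq)
  qed
  then show ?thesis unfolding mg_tree_def using m conn by blast
qed

theorem saturating_order_good:
  assumes G: "multigraph G" and vs: "distinct vs" "set vs = mverts G" "vs \<noteq> []"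
    and sat: "saturates (mends G) vs (medges G) (mverts G \<times> UNIV - {(s, True), (t, False)})"
  shows "\<exists>R. good_ordering G R"
proof -
  let ?V = "mverts G" and ?E = "medges G" and ?d = "mends G"
  define R where "R = {(u, v). precedes vs u v}"
  define D where "D = acyclic_orientation G R"
  note G' = G[unfolded multigraph_def]
  have RV: "R \<subseteq> ?V \<times> ?V" using precedes_in_set vs(2) unfolding R_def by fastforce
  have tr: "trans R" using precedes_trans[OF vs(1)] unfolding R_def trans_def by blast
  have irr: "irrefl R" using precedes_irrefl[OF vs(1)] unfolding R_def irrefl_def by blast
  have tot: "total_on ?V R" using precedes_total vs(2) unfolding R_def total_on_def by fastforce
  have ord: "vertex_ordering G R"
    unfolding vertex_ordering_def strict_linear_order_on_def using RV tr irr tot by blast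
  have asym: "(v, u) \<notin> R" if "(u, v) \<in> R" for u v
    using that tr irr unfolding trans_def irrefl_def by blast
  have orient: "tail D e = u \<and> head D e = v" if "?d e = {u, v}" "(u, v) \<in> R" for e u v
  proof -
    have "(\<exists>y. ?d e = {x, y} \<and> (x, y) \<in> R) \<longleftrightarrow> x = u" for x
      using that asym by (auto simp: doubleton_eq_iff)
    moreover have "(\<exists>x. ?d e = {x, y} \<and> (x, y) \<in> R) \<longleftrightarrow> y = v" for y
      using that asym by (auto simp: doubleton_eq_iff)
    ultimately show ?thesis unfolding D_def acyclic_orientation_def by simp
  qed
  have edge: "?d e = {tail D e, head D e} \<and> (tail D e, head D e) \<in> R" if e: "e \<in> ?E" for e
  proof -
    obtain a b where ab: "?d e = {a, b}" "a \<noteq> b" using G' e by (meson card_2_iff)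
    then have "a \<in> ?V" "b \<in> ?V" using G' e by auto
    then have "(a, b) \<in> R \<or> (b, a) \<in> R" using tot ab(2) unfolding total_on_def by blast
    then show ?thesis using orient[of e a b] orient[of e b a] ab(1) by (auto simp: insert_commute)
  qed
  have D: "verts D = ?V" "arcs D = ?E" unfolding D_def acyclic_orientation_def by simp_all
  have wfD: "wf_digraph (D\<lparr>arcs := B\<rparr>)" if "B \<subseteq> ?E" for B
    using that edge RV D by unfold_locales auto
  have DE: "D\<lparr>arcs := ?E\<rparr> = D" using D(2) by (cases D) simp
  have wfD': "wf_digraph D" using wfD[of ?E] unfolding DE by simp
  have sp: "spanning (D\<lparr>arcs := B\<rparr>) D" if "B \<subseteq> ?E" for B
    unfolding spanning_def subgraph_def compatible_def using wfD[OF that] wfD' that D by simp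
  have mgD: "multigraph (underlying (D\<lparr>arcs := B\<rparr>))" if B: "B \<subseteq> ?E" for B
  proof -
    have "card {tail D e, head D e} = 2 \<and> {tail D e, head D e} \<subseteq> ?V" if "e \<in> B" for e
    proof -
      have e: "e \<in> ?E" using B that by blast
      then have "{tail D e, head D e} = ?d e" using edge[OF e] by simp
      then show ?thesis using G' e by simp
    qed
    moreover have "finite B" using G' B finite_subset by blast
    ultimately show ?thesis using G' D unfolding underlying_def multigraph_def by simp
  qed
  have tree: "mg_spanning_tree (underlying (D\<lparr>arcs := B\<rparr>)) (underlying D)"
    if B: "B \<subseteq> ?E" and T: "mg_tree \<lparr>mverts = ?V, medges = B, mends = (\<lambda>a. {tail D a, head D a})\<rparr>" for B
  proof -
    have "multigraph (underlying D)" using mgD[of ?E] unfolding DE by simp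
    then show ?thesis
      using mgD[OF B] T B D unfolding mg_spanning_tree_def mg_subgraph_def underlying_def by simp
  qed
  let ?S = "?V \<times> UNIV - {(s, True), (t, False)}"
  obtain m where m: "inj_on m ?S" "\<forall>p\<in>?S. m p \<in> ?E \<and> serves ?d vs (m p) p"
    using sat unfolding saturates_def by blast
  have enter: "m (v, True) \<in> ?E \<and> head D (m (v, True)) = v" if "(v, True) \<in> ?S" for v
  proof -
    have "m (v, True) \<in> ?E" "serves ?d vs (m (v, True)) (v, True)" using m(2) that by blast+
    then show ?thesis using orient[of "m (v, True)" _ v] unfolding serves_def R_def by auto
  qed
  have leave: "m (v, False) \<in> ?E \<and> tail D (m (v, False)) = v" if "(v, False) \<in> ?S" for v
  proof -
    have "m (v, False) \<in> ?E" "serves ?d vs (m (v, False)) (v, False)" using m(2) that by blast+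
    then show ?thesis using orient[of "m (v, False)" v] unfolding serves_def R_def
      by (auto simp: insert_commute)
  qed
  \<comment> \<open>The first vertex has no entering arc, so it must be \<open>s\<close>; likewise the last vertex is \<open>t\<close>.\<close>
  have s: "s = hd vs"
  proof (rule ccontr)
    assume "s \<noteq> hd vs"
    then have "(hd vs, True) \<in> ?S" using hd_in_set[OF vs(3)] vs(2) by simp
    from enter[OF this] have e: "m (hd vs, True) \<in> ?E" "head D (m (hd vs, True)) = hd vs" by simp_all
    show False using edge[OF e(1)] precedes_hd[OF vs(1,3)] unfolding R_def e(2) by simp
  qed
  have t: "t = last vs"
  proof (rule ccontr)
    assume "t \<noteq> last vs"
    then have "(last vs, False) \<in> ?S" using last_in_set[OF vs(3)] vs(2) by simp
    from leave[OF this] have e: "m (last vs, False) \<in> ?E" "tail D (m (last vs, False)) = last vs" by simp_all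
    show False using edge[OF e(1)] precedes_last[OF vs(1,3)] unfolding R_def e(2) by simp
  qed
  have stV: "s \<in> ?V" "t \<in> ?V" using hd_in_set[OF vs(3)] last_in_set[OF vs(3)] unfolding s t vs(2) .
  \<comment> \<open>\<open>I\<close> consists of the chosen entering arcs, \<open>J\<close> of the chosen leaving ones.\<close>
  define I where "I = (\<lambda>v. m (v, True)) ` (?V - {s})"
  define J where "J = (\<lambda>v. m (v, False)) ` (?V - {t})"
  have enter': "m (v, True) \<in> ?E" "head D (m (v, True)) = v" if "v \<in> ?V - {s}" for v
    using enter[of v] that by simp_all
  have leave': "m (v, False) \<in> ?E" "tail D (m (v, False)) = v" if "v \<in> ?V - {t}" for v
    using leave[of v] that by simp_all
  have IE: "I \<subseteq> ?E" "J \<subseteq> ?E"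
    unfolding I_def J_def using enter'(1) leave'(1) by blast+
  have fin: "finite I" "finite J" using G' unfolding I_def J_def by auto
  have headI: "inj_on (head D) I" "head D ` I = ?V - {s}"
    unfolding I_def by (auto simp: inj_on_def image_image enter' cong: image_cong_simp)
  have tailJ: "inj_on (tail D) J" "tail D ` J = ?V - {t}"
    unfolding J_def by (auto simp: inj_on_def image_image leave' cong: image_cong_simp)
  have IJ: "I \<inter> J = {}"
  proof (rule equals0I)
    fix e assume "e \<in> I \<inter> J"
    then obtain u v where "(u, True) \<in> ?S" "(v, False) \<in> ?S" "m (u, True) = m (v, False)"
      unfolding I_def J_def by auto
    then show False using m(1) by (auto dest: inj_onD)
  qed
  have count: "card {e \<in> B. f e = v} = (if v \<in> f ` B then 1 else 0)" if "inj_on f B" for f and B :: "'b set" and v :: 'a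
  proof (cases "v \<in> f ` B")
    case True
    then obtain e where e: "e \<in> B" "f e = v" by blast
    then have "{e \<in> B. f e = v} = {e}" using that by (auto dest: inj_onD)
    then show ?thesis using True by simp
  next
    case False
    then have none: "{e \<in> B. f e = v} = {}" by blast
    show ?thesis unfolding none using False by simp
  qed
  have "out_branching D s (D\<lparr>arcs := I\<rparr>)"
  proof -
    have "mg_tree \<lparr>mverts = ?V, medges = I, mends = (\<lambda>a. {tail D a, head D a})\<rparr>"
      by (rule parent_choice_tree[OF _ fin(1) stV(1) RV tr irr, of _ "tail D" "head D"])
        (use G' edge IE headI in auto)
    moreover have "in_degree (D\<lparr>arcs := I\<rparr>) v = (if v \<in> ?V - {s} then 1 else 0)" for v
      using count[OF headI(1), of v] headI(2) unfolding in_degree_def in_arcs_def by simp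
    ultimately show ?thesis
      unfolding out_branching_def using sp[OF IE(1)] tree[OF IE(1)] stV D by simp
  qed
  moreover have "in_branching D t (D\<lparr>arcs := J\<rparr>)"
  proof -
    have "mg_tree \<lparr>mverts = ?V, medges = J, mends = (\<lambda>a. {tail D a, head D a})\<rparr>"
      by (rule parent_choice_tree[OF _ fin(2) stV(2), of "R\<inverse>" _ "head D" "tail D"])
        (use G' edge IE tailJ RV tr irr in \<open>auto simp: irrefl_def insert_commute\<close>)
    moreover have "out_degree (D\<lparr>arcs := J\<rparr>) v = (if v \<in> ?V - {t} then 1 else 0)" for v
      using count[OF tailJ(1), of v] tailJ(2) unfolding out_degree_def out_arcs_def by simp
    ultimately show ?thesis
      unfolding in_branching_def using sp[OF IE(2)] tree[OF IE(2)] stV D by simp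
  qed
  ultimately have "good_ordering G R"
    unfolding good_ordering_def D_def[symmetric] using ord IJ
    by (intro conjI exI[of _ s] exI[of _ t] exI[of _ "D\<lparr>arcs := I\<rparr>"] exI[of _ "D\<lparr>arcs := J\<rparr>"]) simp_all
  then show ?thesis ..
qed

theorem theorem6p1:
  fixes G :: "('v, 'e) mgraph"
  assumes "two_T_graph G"
    and "\<forall>H. generic_component G H \<longrightarrow> circuit_of H G"
    and "mg_matching G (external_edges G)"
  shows "\<exists>R. good_ordering G R"
proof -
  let ?V = "mverts G" and ?E = "medges G" and ?d = "mends G"
  define \<P> where "\<P> = mverts ` {H. circuit_of H G}"
  have t: "tight 2 ?d ?E ?V" using assms(1) by (rule two_T_graph_tight)
  note t' = tightD[OF t]
  have G: "multigraph G" using assms(1) unfolding two_T_graph_def by simp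
  have circ: "generic_circuit (mg_induce G P)" "P \<subseteq> ?V" if "P \<in> \<P>" for P
  proof -
    obtain H where "circuit_of H G" "P = mverts H" using \<open>P \<in> \<P>\<close> unfolding \<P>_def by blast
    then show "generic_circuit (mg_induce G P)" "P \<subseteq> ?V"
      using circuit_of_cases(2,3)[of H G] by simp_all
  qed
  have dis: "disjoint \<P>"
  proof (rule disjointI)
    fix P Q assume "P \<in> \<P>" "Q \<in> \<P>" "P \<noteq> Q"
    then show "P \<inter> Q = {}" using circuits_disjoint[OF assms(2)] unfolding \<P>_def by blast
  qed
  have cover: "\<Union>\<P> = ?V" using circuits_cover[OF assms(2)] circ(2) unfolding \<P>_def by blast
  have counts: "P \<noteq> {} \<and> card (inside ?d ?E P) + 2 = 2 * card P" if "P \<in> \<P>" for P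
    using generic_circuit_counts(2,3)[OF circ(1)[OF that]] by auto
  let ?M = "{e \<in> ?E. \<forall>P\<in>\<P>. \<not> ?d e \<subseteq> P}"
  have inM: "e \<in> medges H \<longleftrightarrow> e \<in> ?E \<and> ?d e \<subseteq> mverts H" if "circuit_of H G" for e H
    using circuit_of_cases(1)[OF that] medges_mg_induce[of G "mverts H"] unfolding inside_def by auto
  have ext: "external_edges G = ?M"
    unfolding external_edges_def \<P>_def using inM by auto
  have "\<exists>vs s t. distinct vs \<and> set vs = \<Union>\<P> \<and>
    saturates ?d vs (?M \<union> \<Union>(inside ?d ?E ` \<P>)) (\<Union>\<P> \<times> UNIV - {(s, True), (t, False)})"
  proof (rule block_order)
    show "tight 2 (blocks_met \<P> ?d) ?M \<P>" by (rule quotient_tight[OF t dis cover counts])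
    show "?d e \<subseteq> \<Union>\<P> \<and> card (?d e) = 2" if "e \<in> ?M" for e
      unfolding cover using t'(3,4)[of e] that by blast
    show "?d e \<inter> ?d f = {}" if "e \<in> ?M" "f \<in> ?M" "e \<noteq> f" for e f
      using assms(3) that unfolding ext mg_matching_def by blast
    show "\<exists>p\<in>P. \<exists>q\<in>P. p \<noteq> q" if P: "P \<in> \<P>" for P
    proof -
      have "P \<noteq> {}" using counts[OF P] by simp
      then obtain p where p: "p \<in> P" by blast
      have "\<not> P \<subseteq> {p}" using generic_circuit_counts(2)[OF circ(1)[OF P]] card_mono[of "{p}" P] by auto
      then show ?thesis using p by blast
    qed
    show "threadable ?d (inside ?d ?E P) P p q" if P: "P \<in> \<P>" and pq: "p \<in> P" "q \<in> P" "p \<noteq> q" for P p q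
    proof (rule circuit_threadable)
      note c = generic_circuit_counts[OF circ(1)[OF P]]
      show "finite P" by (rule c(1))
      show "finite (inside ?d ?E P)" using t'(2) by (rule inside_finite)
      show "?d e \<subseteq> P \<and> card (?d e) = 2" if "e \<in> inside ?d ?E P" for e
        using that t'(4) unfolding inside_def by simp
      show "card (inside ?d ?E P) + 2 = 2 * card P" by (rule c(3))
      show "card (inside ?d (inside ?d ?E P) X) + 3 \<le> 2 * card X" if X: "X \<subset> P" "2 \<le> card X" for X
      proof -
        have "inside ?d (inside ?d ?E P) X = inside ?d ?E X" using X(1) unfolding inside_def by auto
        then show ?thesis using c(4)[OF X] by simp
      qed
    qed (use pq in auto)
    show "inside ?d ?E P \<inter> ?M = {}" if "P \<in> \<P>" for P
      using that unfolding inside_def by blast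
    show "inside ?d ?E P \<inter> inside ?d ?E Q = {}" if "P \<in> \<P>" "Q \<in> \<P>" "P \<noteq> Q" for P Q
    proof (rule equals0I)
      fix e assume e: "e \<in> inside ?d ?E P \<inter> inside ?d ?E Q"
      then have "?d e \<subseteq> P \<inter> Q" "card (?d e) = 2" using t'(4) unfolding inside_def by auto
      then show False using disjointD[OF dis that] by auto
    qed
  qed (rule dis)
  then obtain vs s t where vs: "distinct vs" "set vs = ?V"
    and sat: "saturates ?d vs (?M \<union> \<Union>(inside ?d ?E ` \<P>)) (?V \<times> UNIV - {(s, True), (t, False)})"
    unfolding cover by blast
  have "saturates ?d vs ?E (?V \<times> UNIV - {(s, True), (t, False)})"
    by (rule saturates_mono[OF sat]) (auto simp: inside_def)
  moreover have "vs \<noteq> []" using t'(6) vs by auto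
  ultimately show ?thesis using saturating_order_good[OF G vs] by blast
qed

end
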